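(* Let $m\ge 2$, $N\ge 1$, and let $O_1,\dots,O_N$ be obstacles on the torus $\mathbb{T}^m=\mathbb{R}^m/\mathbb{Z}^m$ satisfying the standing assumptions listed in the context. Then the set of rotation vectors of periodic orbits of admissible type is dense in the admissible rotation set $AR$.
   Context: Setting. $m\ge 2$, $\mathbb{T}^m=\mathbb{R}^m/\mathbb{Z}^m$, $\phi:\mathbb{R}^m\to\mathbb{T}^m$ is the natural covering, $S_0=[0,1]^m$. The obstacles $O_1,\dots,O_N\subset\mathbb{T}^m$ are pairwise disjoint strictly convex bodies (compact, with nonempty interior) with $C^2$ boundary and diameter less than $\frac{\sqrt2}{4}$. Coordinates are chosen so that $O_{(\mathbf 0,r)}:=\phi^{-1}(O_r)\cap[0,1]^m$ is a copy of $O_r$ contained in the interior of $[0,1]^m$ for each $r$. For $\mathbf k\in\mathbb{Z}^m$ put $O_{(\mathbf k,r)}=O_{(\mathbf 0,r)}+\mathbf k$; these sets are called obstacles in $\mathbb{R}^m$. Standing assumptions: (a) for every coordinate projection $\pi_i(x_1,\dots,x_m)=x_i$ and all $r\ne r'$, $\pi_i(O_{(\mathbf 0,r)})\cap\pi_i(O_{(\mathbf 0,r')})=\emptyset$; (b) no-eclipse in $S_0$: for pairwise distinct $r,s,t$, the convex hull of $O_{(\mathbf 0,r)}\cup O_{(\mathbf 0,s)}$ is disjoint from $O_{(\mathbf 0,t)}$. Billiard. Trajectories are considered in $\Omega=\overline{\mathbb{R}^m\setminus\bigcup_{\mathbf k,r}O_{(\mathbf k,r)}}$: straight motion with unit speed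 inside $\Omega$ and reflection at the boundary with angle of incidence equal to angle of reflection. Their projections under $\phi$ are billiard trajectories in $\overline{\mathbb{T}^m\setminus\bigcup_rO_r}$. A trajectory (piece) is of type $(\mathbf k_n,r_n)_{n=0}^p$ ($p\le\infty$) if it (or a continuous lifting of it to $\mathbb{R}^m$) starts at a point of $\partial O_{(\mathbf k_0,r_0)}$ and its consecutive reflections are from $O_{(\mathbf k_n,r_n)}$, $n=1,2,\dots$; for $p<\infty$ the piece ends at a point of $\partial O_{(\mathbf k_p,r_p)}$. Between. An obstacle $O_{(\mathbf k,r)}$, different from $O_{(\mathbf i,s)}$ and $O_{(\mathbf j,t)}$, is between $O_{(\mathbf i,s)}$ and $O_{(\mathbf j,t)}$ if it has a common point with the convex hull of $O_{(\mathbf i,s)}\cup O_{(\mathbf j,t)}$. Admissible sequence. A sequence $(\mathbf k_n,r_n)_{n=0}^p$ in $\mathbb{Z}^m\times\{1,\dots,N\}$ ($p$ finite or $\infty$) is admissible if (i) $\mathbf k_0=\mathbf 0$; (ii) $(\mathbf k_{n+1},r_{n+1})\neq(\mathbf k_n,r_n)$ for every $n<p$; (iii) for every $n<p$ there is no obstacle between $O_{(\mathbf k_n,r_n)}$ and $O_{(\mathbf k_{n+1},r_{n+1})}$; (iv) for every $n<p-1$ the obstacle $O_{(\mathbf k_{n+1},r_{n+1})}$ is not between $O_{(\mathbf k_n,r_n)}$ and $O_{(\mathbf k_{n+2},r_{n+2})}$. Admissible rotation set. For a trajectory piece $T$ from $\mathbf x$ to $\mathbf y$ in $\mathbb{R}^m$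 let $|T|$ be its length and $d(T)=\mathbf y-\mathbf x$ its displacement. $AR$ is the set of all limit points of sequences $\left(\frac{d(T_n)}{|T_n|}\right)_{n\ge1}$, where each $T_n$ is a trajectory piece whose type is a (finite) admissible sequence and $|T_n|\to\infty$. Periodic orbits. A periodic orbit is a billiard trajectory that is periodic on the torus; it is of admissible type if its type is an (infinite) admissible sequence. If $P$ is the lifted piece of the trajectory representing one period, the rotation vector of the periodic orbit is $\frac{d(P)}{|P|}$. *)

theory Defs
  imports "HOL-Analysis.Analysis" "HOL-Library.Extended_Nat" "HOL-Library.Extended_Real"
begin

section \<open>The torus and the obstacles\<close>

definition lattice_vec :: "int ^ 'm \<Rightarrow> real ^ 'm::finite" where
  "lattice_vec k = (\<chi> i. real_of_int (k $ i))"

text \<open>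
  The torus is the set of cosets of the integer lattice, i.e. \<open>range torus_proj\<close>, and
  \<open>torus_proj\<close> is the natural covering.
\<close>

definition torus_proj :: "real ^ 'm::finite \<Rightarrow> (real ^ 'm) set" where
  "torus_proj x = range (\<lambda>k. x + lattice_vec k)"

definition strictly_convex_body :: "'a::euclidean_space set \<Rightarrow> bool" where
  "strictly_convex_body K \<longleftrightarrow>
     compact K \<and> interior K \<noteq> {} \<and>
     (\<forall>x\<in>K. \<forall>y\<in>K. x \<noteq> y \<longrightarrow> open_segment x y \<subseteq> interior K)"

text \<open>
  \<open>g\<close> and \<open>H\<close> are the gradient and the Hessian of the local defining function \<open>f\<close>.
\<close>

definition C2_boundary :: "(real ^ 'm::finite) set \<Rightarrow> bool" where
  "C2_boundary K \<longleftrightarrow>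
     (\<forall>x\<in>frontier K. \<exists>U f (g :: real ^ 'm \<Rightarrow> real ^ 'm) (H :: real ^ 'm \<Rightarrow> real ^ 'm ^ 'm).
        open U \<and> x \<in> U \<and>
        (\<forall>y\<in>U. (f has_derivative (\<lambda>h. g y \<bullet> h)) (at y)) \<and>
        (\<forall>y\<in>U. (g has_derivative (\<lambda>h. H y *v h)) (at y)) \<and>
        continuous_on U H \<and>
        (\<forall>y\<in>U. g y \<noteq> 0) \<and>
        K \<inter> U = {y\<in>U. f y \<le> 0})"

text \<open>
  A family \<open>Ob\<close> of subsets of the torus is indexed by \<open>r \<in> {1..N}\<close>. When \<open>base_obstacle Ob r\<close>
  lies in the interior of the unit cube, \<open>torus_proj\<close> restricts to a bijection from it onto
  \<open>Ob r\<close>, so that convexity, smoothness and diameter of \<open>Ob r\<close> can be read off from this copy.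
\<close>

definition base_obstacle :: "(nat \<Rightarrow> (real ^ 'm::finite) set set) \<Rightarrow> nat \<Rightarrow> (real ^ 'm) set" where
  "base_obstacle Ob r = torus_proj -` Ob r \<inter> cbox 0 1"

definition obstacle ::
  "(nat \<Rightarrow> (real ^ 'm::finite) set set) \<Rightarrow> (int ^ 'm) \<times> nat \<Rightarrow> (real ^ 'm) set" where
  "obstacle Ob i = (\<lambda>x. x + lattice_vec (fst i)) ` base_obstacle Ob (snd i)"

definition obstacle_indices :: "nat \<Rightarrow> ((int ^ 'm::finite) \<times> nat) set" where
  "obstacle_indices N = UNIV \<times> {1..N}"

section \<open>Billiard trajectories\<close>

definition billiard_domain :: "nat \<Rightarrow> (nat \<Rightarrow> (real ^ 'm::finite) set set) \<Rightarrow> (real ^ 'm) set" where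
  "billiard_domain N Ob = closure (UNIV - (\<Union>i\<in>obstacle_indices N. obstacle Ob i))"

definition incoming_velocity :: "(real \<Rightarrow> 'a::euclidean_space) \<Rightarrow> real \<Rightarrow> 'a \<Rightarrow> bool" where
  "incoming_velocity \<gamma> t v \<longleftrightarrow>
     norm v = 1 \<and> (\<exists>e>0. \<forall>s\<in>{t-e<..t}. \<gamma> s = \<gamma> t + (s - t) *\<^sub>R v)"

definition outgoing_velocity :: "(real \<Rightarrow> 'a::euclidean_space) \<Rightarrow> real \<Rightarrow> 'a \<Rightarrow> bool" where
  "outgoing_velocity \<gamma> t v \<longleftrightarrow>
     norm v = 1 \<and> (\<exists>e>0. \<forall>s\<in>{t..<t+e}. \<gamma> s = \<gamma> t + (s - t) *\<^sub>R v)"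

text \<open>
  For a convex body with differentiable boundary there is exactly one such \<open>\<nu>\<close> at every
  boundary point.
\<close>

definition outward_unit_normal :: "'a::euclidean_space set \<Rightarrow> 'a \<Rightarrow> 'a \<Rightarrow> bool" where
  "outward_unit_normal K x \<nu> \<longleftrightarrow> norm \<nu> = 1 \<and> (\<forall>y\<in>K. \<nu> \<bullet> (y - x) \<le> 0)"

text \<open>
  \<open>billiard_trajectory N Ob L \<gamma>\<close>: \<open>\<gamma>\<close>, restricted to the times \<open>0 \<le> t \<le> L\<close> (all \<open>t \<ge> 0\<close> if
  \<open>L = \<infinity>\<close>), is a billiard trajectory parametrized by arc length. The values of \<open>\<gamma>\<close> at other
  times are irrelevant.
\<close>

definition billiard_trajectory ::
  "nat \<Rightarrow> (nat \<Rightarrow> (real ^ 'm::finite) set set) \<Rightarrow> ereal \<Rightarrow> (real \<Rightarrow> real ^ 'm) \<Rightarrow> bool" where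
  "billiard_trajectory N Ob L \<gamma> \<longleftrightarrow>
     0 \<le> L \<and>
     (\<forall>t. 0 \<le> t \<and> ereal t \<le> L \<longrightarrow> \<gamma> t \<in> billiard_domain N Ob) \<and>
     (\<forall>t. 0 < t \<and> ereal t \<le> L \<longrightarrow> (\<exists>v. incoming_velocity \<gamma> t v)) \<and>
     (\<forall>t. 0 \<le> t \<and> ereal t < L \<longrightarrow> (\<exists>w. outgoing_velocity \<gamma> t w)) \<and>
     (\<forall>t v w. 0 < t \<and> ereal t < L \<and> incoming_velocity \<gamma> t v \<and> outgoing_velocity \<gamma> t w \<longrightarrow>
        (\<forall>i\<in>obstacle_indices N. \<gamma> t \<in> frontier (obstacle Ob i) \<longrightarrow>
           (\<exists>\<nu>. outward_unit_normal (obstacle Ob i) (\<gamma> t) \<nu> \<and> w = v - (2 * (v \<bullet> \<nu>)) *\<^sub>R \<nu>)) \<and>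
        ((\<forall>i\<in>obstacle_indices N. \<gamma> t \<notin> frontier (obstacle Ob i)) \<longrightarrow> w = v))"

text \<open>
  The numbers \<open>\<tau> n\<close> are the times at which the trajectory meets the boundary of an obstacle.
  Tangential contacts are thus counted as reflections (with unchanged velocity). On trajectories
  whose type is admissible in the sense below there are none, except possibly at the endpoints.
  A finite piece ends at its last contact.
\<close>

definition has_type ::
  "nat \<Rightarrow> (nat \<Rightarrow> (real ^ 'm::finite) set set) \<Rightarrow> ereal \<Rightarrow> (real \<Rightarrow> real ^ 'm) \<Rightarrow>
   (nat \<Rightarrow> (int ^ 'm) \<times> nat) \<Rightarrow> enat \<Rightarrow> bool" where
  "has_type N Ob L \<gamma> K p \<longleftrightarrow>
     (\<exists>\<tau> :: nat \<Rightarrow> real.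
        strict_mono_on {n. enat n \<le> p} \<tau> \<and> \<tau> 0 = 0 \<and>
        {t. 0 \<le> t \<and> ereal t \<le> L \<and> (\<exists>i\<in>obstacle_indices N. \<gamma> t \<in> frontier (obstacle Ob i))}
          = \<tau> ` {n. enat n \<le> p} \<and>
        (\<forall>n. enat n \<le> p \<longrightarrow>
           K n \<in> obstacle_indices N \<and> \<gamma> (\<tau> n) \<in> frontier (obstacle Ob (K n))) \<and>
        L = (case p of enat q \<Rightarrow> ereal (\<tau> q) | \<infinity> \<Rightarrow> \<infinity>))"

section \<open>Admissible sequences and rotation sets\<close>

definition obstacle_between ::
  "nat \<Rightarrow> (nat \<Rightarrow> (real ^ 'm::finite) set set) \<Rightarrow> (int ^ 'm) \<times> nat \<Rightarrow> (int ^ 'm) \<times> nat \<Rightarrow>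
   (int ^ 'm) \<times> nat \<Rightarrow> bool" where
  "obstacle_between N Ob l i j \<longleftrightarrow>
     l \<in> obstacle_indices N \<and> l \<noteq> i \<and> l \<noteq> j \<and>
     obstacle Ob l \<inter> convex hull (obstacle Ob i \<union> obstacle Ob j) \<noteq> {}"

text \<open>
  A sequence \<open>(K n)\<close>, \<open>0 \<le> n \<le> p\<close>, is given by a total function \<open>K\<close> whose values beyond \<open>p\<close> are
  ignored.
\<close>

definition admissible_sequence ::
  "nat \<Rightarrow> (nat \<Rightarrow> (real ^ 'm::finite) set set) \<Rightarrow> (nat \<Rightarrow> (int ^ 'm) \<times> nat) \<Rightarrow> enat \<Rightarrow> bool" where
  "admissible_sequence N Ob K p \<longleftrightarrow>
     (\<forall>n. enat n \<le> p \<longrightarrow> K n \<in> obstacle_indices N) \<and>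
     fst (K 0) = 0 \<and>
     (\<forall>n. enat n < p \<longrightarrow> K (Suc n) \<noteq> K n) \<and>
     (\<forall>n. enat n < p \<longrightarrow> \<not> (\<exists>l. obstacle_between N Ob l (K n) (K (Suc n)))) \<and>
     (\<forall>n. enat (Suc n) < p \<longrightarrow> \<not> obstacle_between N Ob (K (Suc n)) (K n) (K (Suc (Suc n))))"

definition admissible_piece ::
  "nat \<Rightarrow> (nat \<Rightarrow> (real ^ 'm::finite) set set) \<Rightarrow> real \<Rightarrow> (real \<Rightarrow> real ^ 'm) \<Rightarrow> bool" where
  "admissible_piece N Ob L \<gamma> \<longleftrightarrow>
     billiard_trajectory N Ob (ereal L) \<gamma> \<and>
     (\<exists>K p. has_type N Ob (ereal L) \<gamma> K (enat p) \<and> admissible_sequence N Ob K (enat p))"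

text \<open>
  Since trajectories have unit speed, the length of a piece is its duration \<open>L\<close>. Limit points of
  a sequence are the limits of its subsequences.
\<close>

definition displacement :: "real \<Rightarrow> (real \<Rightarrow> 'a::euclidean_space) \<Rightarrow> 'a" where
  "displacement L \<gamma> = \<gamma> L - \<gamma> 0"

definition admissible_rotation_set ::
  "nat \<Rightarrow> (nat \<Rightarrow> (real ^ 'm::finite) set set) \<Rightarrow> (real ^ 'm) set" where
  "admissible_rotation_set N Ob =
     {x. \<exists>L \<gamma> \<sigma>. (\<forall>n::nat. admissible_piece N Ob (L n) (\<gamma> n)) \<and>
           filterlim L at_top sequentially \<and>
           strict_mono (\<sigma> :: nat \<Rightarrow> nat) \<and>
           (\<lambda>n. displacement (L (\<sigma> n)) (\<gamma> (\<sigma> n)) /\<^sub>R L (\<sigma> n)) \<longlonglongrightarrow> x}"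

text \<open>
  \<open>\<gamma>\<close> is a lifting to the Euclidean space of a trajectory on the torus with period \<open>T\<close>.
\<close>

definition admissible_periodic_orbit ::
  "nat \<Rightarrow> (nat \<Rightarrow> (real ^ 'm::finite) set set) \<Rightarrow> real \<Rightarrow> (real \<Rightarrow> real ^ 'm) \<Rightarrow> bool" where
  "admissible_periodic_orbit N Ob T \<gamma> \<longleftrightarrow>
     billiard_trajectory N Ob \<infinity> \<gamma> \<and>
     T > 0 \<and> (\<forall>t\<ge>0. torus_proj (\<gamma> (t + T)) = torus_proj (\<gamma> t)) \<and>
     (\<exists>K. has_type N Ob \<infinity> \<gamma> K \<infinity> \<and> admissible_sequence N Ob K \<infinity>)"

definition periodic_rotation_vectors ::
  "nat \<Rightarrow> (nat \<Rightarrow> (real ^ 'm::finite) set set) \<Rightarrow> (real ^ 'm) set" where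
  "periodic_rotation_vectors N Ob =
     {displacement T \<gamma> /\<^sub>R T | T \<gamma>. admissible_periodic_orbit N Ob T \<gamma>}"

end

theory Submission
  imports Defs
begin

text \<open>
  The length of a polygon with vertices in prescribed convex bodies is a convex function of the
  vertices, and the reflection law is its first-order condition. Hence a trajectory piece is the
  shortest polygon of its type between its endpoints, and conversely a shortest closed polygon
  (modulo a lattice translation) visiting the obstacles of an admissible sequence is a periodic
  billiard orbit of that type. Any two pairs of mutually visible obstacles whose inner members lie in
  the same unit cube can be joined by an admissible sequence, so every finite admissible sequence
  closes up to a periodic one at a uniformly bounded cost; minimality then shows that period and
  displacement of the resulting orbit differ from those of the piece by a bounded amount.

  Conversely the contact times of a periodic orbit include all multiples of the period, which cut it
  into admissible pieces with the same rotation vector.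
\<close>

section \<open>Polygons and convex bodies\<close>

text \<open>Vertices range over the filled obstacles, not over their boundaries, so that competitors
  form a convex compact set. With \<open>u\<close> the unit directions of the edges, first-order
  optimality reads \<open>0 \<le> (u n - u (Suc n)) \<bullet> (y - x (Suc n))\<close> for all
  \<open>y\<close> in the obstacle. For a trajectory this is the reflection law plus the fact that
  it does not arrive through the obstacle. Conversely a minimizer could pass a vertex without
  turning; condition (iv) excludes this. The change of direction is then an outward normal, so the
  vertex lies on the boundary and the edges stay outside the obstacles at their ends, while (iii)
  keeps them off all others.

  Connectivity reduces to one obstacle \<open>j\<close>: which of its neighbours are joined by turns
  at \<open>j\<close>. Its unit translates serve as hubs. A coordinate varies by less than 1/2 on an
  obstacle, so a sum of two signed coordinates varies by less than 1, which a single unit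
  translation makes up for. Hubs on the same axis are linked through a hub on another axis, which
  needs dimension at least 2.\<close>

lemma norm_sum_minimizer_first_order:
  fixes a b x :: "'a::real_inner"
  assumes "convex S" "x \<in> S" "x \<noteq> a" "x \<noteq> b" "y \<in> S"
    and min: "\<And>y. y \<in> S \<Longrightarrow> norm (x - a) + norm (b - x) \<le> norm (y - a) + norm (b - y)"
  shows "0 \<le> (sgn (x - a) - sgn (b - x)) \<bullet> (y - x)"
proof (rule ccontr)
  define d where "d = y - x"
  define f where "f s = norm (x + s *\<^sub>R d - a) + norm (b - (x + s *\<^sub>R d))" for s :: real
  define l where "l = (sgn (x - a) - sgn (b - x)) \<bullet> d"
  assume "\<not> ?thesis"
  then have "l < 0" by (simp add: l_def d_def)
  have norm_derivative: "((\<lambda>s. norm (F s)) has_derivative (\<lambda>h. sgn (F 0) \<bullet> F' h)) (at 0)"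
    if "(F has_derivative F') (at 0)" "F 0 \<noteq> 0" for F :: "real \<Rightarrow> 'a" and F'
    using has_derivative_compose[OF that(1) has_derivative_norm[OF that(2)]] by (simp add: inner_commute)
  have d1: "((\<lambda>s. norm (x + s *\<^sub>R d - a)) has_derivative (\<lambda>h. sgn (x - a) \<bullet> (h *\<^sub>R d))) (at 0)"
    using norm_derivative[of "\<lambda>s. x + s *\<^sub>R d - a" "\<lambda>h. h *\<^sub>R d"] assms(3)
    by (force intro!: derivative_eq_intros)
  have d2: "((\<lambda>s. norm (b - (x + s *\<^sub>R d))) has_derivative (\<lambda>h. sgn (b - x) \<bullet> (- (h *\<^sub>R d)))) (at 0)"
    using norm_derivative[of "\<lambda>s. b - (x + s *\<^sub>R d)" "\<lambda>h. - (h *\<^sub>R d)"] assms(4)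
    by (force intro!: derivative_eq_intros)
  have "(f has_derivative (\<lambda>h. sgn (x - a) \<bullet> (h *\<^sub>R d) + sgn (b - x) \<bullet> (- (h *\<^sub>R d)))) (at 0)"
    unfolding f_def by (rule has_derivative_add[OF d1 d2])
  also have "(\<lambda>h. sgn (x - a) \<bullet> (h *\<^sub>R d) + sgn (b - x) \<bullet> (- (h *\<^sub>R d))) = (*) l"
    by (auto simp: l_def algebra_simps)
  finally have "(f has_real_derivative l) (at 0 within UNIV)"
    by (simp add: has_field_derivative_def)
  \<comment> \<open>With a negative slope, a small step towards \<open>y\<close>, which stays in
    \<open>S\<close> by convexity, would give a shorter path.\<close>
  from has_real_derivative_neg_dec_right[OF this \<open>l < 0\<close>]
  obtain e where e: "e > 0" "\<And>h. h > 0 \<Longrightarrow> h < e \<Longrightarrow> f h < f 0" by auto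
  define h where "h = min (e / 2) 1"
  have h: "h > 0" "h < e" "h \<le> 1" using e(1) by (auto simp: h_def)
  have "x + h *\<^sub>R d = (1 - h) *\<^sub>R x + h *\<^sub>R y"
    by (simp add: d_def algebra_simps)
  also have "\<dots> \<in> S"
    using h assms(1,2,5) by (intro convexD) auto
  finally have "f 0 \<le> f h"
    using min by (simp add: f_def)
  with e(2) h show False by fastforce
qed

text \<open>The directions \<open>u\<close> give a subgradient of the convex length functional at
  \<open>x\<close>. Summation by parts leaves products at the inner vertices, nonnegative by the
  last hypothesis, and two endpoint terms, which remain in the bound because the ends of
  \<open>x\<close> need not be optimal.\<close>

lemma polygon_length_lower_bound:
  fixes x y :: "nat \<Rightarrow> 'a::real_inner"
  assumes "\<And>n. n < p \<Longrightarrow> x (Suc n) = x n + d n *\<^sub>R u n"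
    and "\<And>n. n < p \<Longrightarrow> norm (u n) = 1"
    and "\<And>n. Suc n < p \<Longrightarrow> 0 \<le> (u n - u (Suc n)) \<bullet> (y (Suc n) - x (Suc n))"
  shows "(\<Sum>n<p. d n) \<le> (\<Sum>n<p. norm (y (Suc n) - y n)) + norm (y 0 - x 0) + norm (y p - x p)"
proof (cases p)
  case (Suc q)
  have split: "d n + u n \<bullet> (y (Suc n) - x (Suc n)) = u n \<bullet> (y (Suc n) - y n) + u n \<bullet> (y n - x n)"
    if "n < p" for n
  proof -
    have "u n \<bullet> u n = 1" using assms(2)[OF that] by (simp add: dot_square_norm)
    then show ?thesis using assms(1)[OF that] by (simp add: algebra_simps)
  qed
  have cs: "u n \<bullet> v \<le> norm v" if "n < p" for n v
    using norm_cauchy_schwarz[of "u n" v] assms(2)[OF that] by simp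
  \<comment> \<open>The induction carries the boundary term at the right end of the last edge; it is
    estimated by a norm only after the last step.\<close>
  have "Suc q \<le> p \<Longrightarrow> (\<Sum>n<Suc q. d n) + u q \<bullet> (y (Suc q) - x (Suc q))
      \<le> (\<Sum>n<Suc q. norm (y (Suc n) - y n)) + norm (y 0 - x 0)"
  proof (induction q)
    case 0
    then show ?case using split[of 0] cs[of 0 "y 1 - y 0"] cs[of 0 "y 0 - x 0"] by simp
  next
    case (Suc q)
    then show ?case
      using split[of "Suc q"] cs[of "Suc q" "y (Suc (Suc q)) - y (Suc q)"] assms(3)[of q]
      by (simp add: inner_diff_left)
  qed
  with Suc cs[of q "x p - y p"] show ?thesis
    by (simp add: inner_diff_right norm_minus_commute)
qed simp

text \<open>Shows later that a trajectory arriving at \<open>x\<close> with velocity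
  \<open>v\<close> has \<open>v \<bullet> \<nu> \<le> 0\<close>, since otherwise it would have come
  out of the interior. The defining function decreases strictly along any \<open>h\<close> with
  \<open>g x \<bullet> h < 0\<close>, and points where it is negative are interior.\<close>

lemma C2_boundary_inward:
  fixes K :: "(real ^ 'm::finite) set"
  assumes "C2_boundary K" "closed K" "x \<in> frontier K" "outward_unit_normal K x \<nu>" "0 < v \<bullet> \<nu>"
  obtains e where "e > 0" "\<And>s. 0 < s \<Longrightarrow> s < e \<Longrightarrow> x - s *\<^sub>R v \<in> interior K"
proof -
  from bspec[OF assms(1)[unfolded C2_boundary_def] assms(3)]
  obtain U f and g :: "real ^ 'm \<Rightarrow> real ^ 'm"
    where U: "open U" "x \<in> U" and f': "\<forall>y\<in>U. (f has_derivative (\<lambda>h. g y \<bullet> h)) (at y)"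
      and g': "\<forall>y\<in>U. g y \<noteq> 0" and K: "K \<inter> U = {y\<in>U. f y \<le> (0::real)}"
    by (elim exE conjE) (rule that; assumption)
  have f: "\<And>y. y \<in> U \<Longrightarrow> (f has_derivative (\<lambda>h. g y \<bullet> h)) (at y)" and g: "g x \<noteq> 0"
    using f' g' U by auto
  have xK: "x \<in> K" using assms(2,3) frontier_subset_closed by blast
  with K U have fx: "f x \<le> 0" by blast
  have "continuous_on U f"
    using f by (meson has_derivative_continuous continuous_at_imp_continuous_on)
  then have "open (f -` {..<0} \<inter> U)"
    using spec[OF iffD1[OF continuous_on_open_vimage[OF U(1)]], of f "{..<0}"] by simp
  moreover have "f -` {..<0} \<inter> U = {y\<in>U. f y < 0}" by auto
  ultimately have "open {y\<in>U. f y < 0}" by simp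
  moreover have "{y\<in>U. f y < 0} \<subseteq> K"
  proof
    fix y assume "y \<in> {y\<in>U. f y < 0}"
    then have "y \<in> K \<inter> U" unfolding K by simp
    then show "y \<in> K" by simp
  qed
  ultimately have int: "{y\<in>U. f y < 0} \<subseteq> interior K" by (simp add: interior_maximal)
  have inward: "\<exists>e>0. \<forall>s. 0 < s \<and> s < e \<longrightarrow> x + s *\<^sub>R h \<in> interior K" if "g x \<bullet> h < 0" for h
  proof -
    have "((\<lambda>s. f (x + s *\<^sub>R h)) has_derivative (\<lambda>t. g x \<bullet> (t *\<^sub>R h))) (at 0)"
    proof (rule has_derivative_compose[of "\<lambda>s. x + s *\<^sub>R h" "\<lambda>t. t *\<^sub>R h"])
      show "((\<lambda>s. x + s *\<^sub>R h) has_derivative (\<lambda>t. t *\<^sub>R h)) (at 0)"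
        by (auto intro!: derivative_eq_intros)
      show "(f has_derivative (\<bullet>) (g x)) (at (x + 0 *\<^sub>R h))"
        using f[OF U(2)] by simp
    qed
    moreover have "(\<lambda>t. g x \<bullet> (t *\<^sub>R h)) = (*) (g x \<bullet> h)" by auto
    ultimately have "((\<lambda>s. f (x + s *\<^sub>R h)) has_real_derivative g x \<bullet> h) (at 0 within UNIV)"
      by (simp add: has_field_derivative_def)
    from has_real_derivative_neg_dec_right[OF this that]
    obtain e1 where e1: "e1 > 0" "\<And>s. 0 < s \<Longrightarrow> s < e1 \<Longrightarrow> f (x + s *\<^sub>R h) < f x" by auto
    have "\<forall>\<^sub>F s in at_right 0. x + s *\<^sub>R h \<in> U"
      by (rule topological_tendstoD[OF _ U(1)]) (auto intro!: tendsto_eq_intros U)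
    then obtain e2 where e2: "e2 > 0" "\<And>s. 0 < s \<Longrightarrow> s < e2 \<Longrightarrow> x + s *\<^sub>R h \<in> U"
      by (auto simp: eventually_at_right_field)
    have "x + s *\<^sub>R h \<in> interior K" if "0 < s" "s < min e1 e2" for s
      using that e1(2)[of s] e2(2)[of s] fx int by force
    then show ?thesis using e1(1) e2(1) by (meson min_less_iff_conj)
  qed
  have nu: "\<nu> \<bullet> h \<le> 0" if h: "g x \<bullet> h < 0" for h
  proof -
    from inward[OF h] obtain e where e: "e > 0" "\<And>s. 0 < s \<Longrightarrow> s < e \<Longrightarrow> x + s *\<^sub>R h \<in> K"
      using interior_subset by blast
    then have "\<nu> \<bullet> ((e / 2) *\<^sub>R h) \<le> 0"
      using assms(4) e(2)[of "e / 2"] unfolding outward_unit_normal_def by (metis add_diff_cancel_left' half_gt_zero field_sum_of_halves less_add_same_cancel1)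
    then show ?thesis using e(1) by (simp add: mult_le_0_iff)
  qed
  \<comment> \<open>No proof that \<open>\<nu>\<close> is parallel to \<open>g x\<close> is
    required: if \<open>g x \<bullet> v \<le> 0\<close>, all vectors
    \<open>v - e *\<^sub>R g x\<close> with \<open>e > 0\<close> point inward, and letting
    \<open>e\<close> tend to 0 gives \<open>\<nu> \<bullet> v \<le> 0\<close>.\<close>
  have "0 < g x \<bullet> v"
  proof (rule ccontr)
    assume "\<not> 0 < g x \<bullet> v"
    then have "\<nu> \<bullet> (v - e *\<^sub>R g x) \<le> 0" if "e > 0" for e
    proof (intro nu)
      have "0 < e * (g x \<bullet> g x)" using that g by simp
      then show "g x \<bullet> (v - e *\<^sub>R g x) < 0"
        using \<open>\<not> 0 < g x \<bullet> v\<close> by (simp add: inner_diff_right)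
    qed
    then have *: "\<nu> \<bullet> v \<le> e * (\<nu> \<bullet> g x)" if "e > 0" for e
      using that by (simp add: inner_diff_right)
    have "((\<lambda>e. e * (\<nu> \<bullet> g x)) \<longlongrightarrow> 0) (at_right 0)" by (auto intro!: tendsto_eq_intros)
    then have "\<nu> \<bullet> v \<le> 0"
      by (rule tendsto_lowerbound) (auto intro!: * exI[of _ "1::real"] simp: eventually_at_right_field)
    with assms(5) show False by (simp add: inner_commute)
  qed
  then have "g x \<bullet> (- v) < 0" by simp
  from inward[OF this] that show ?thesis by auto
qed

text \<open>A polygon closed modulo the translation \<open>\<kappa>\<close> is unrolled to an
  infinite sequence with \<open>P\<close> free vertices, so that the closing edge from
  \<open>P - 1\<close> to \<open>P\<close> is an edge like any other.\<close>

definition wrap :: "nat \<Rightarrow> 'a::real_vector \<Rightarrow> (nat \<Rightarrow> 'a) \<Rightarrow> nat \<Rightarrow> 'a" where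
  "wrap P \<kappa> z n = z (n mod P) + real (n div P) *\<^sub>R \<kappa>"

lemma wrap_eq [simp]: "n < P \<Longrightarrow> wrap P \<kappa> z n = z n"
  by (simp add: wrap_def)

lemma wrap_add_period: "0 < P \<Longrightarrow> wrap P \<kappa> z (n + P) = wrap P \<kappa> z n + \<kappa>"
  by (simp add: wrap_def algebra_simps)

lemma quasi_periodic_mult:
  assumes "\<And>n. z (n + P) = z n + (\<kappa> :: 'a::real_vector)"
  shows "z (m + q * P) = z m + real q *\<^sub>R \<kappa>"
proof (induction q)
  case (Suc q)
  then show ?case using assms[of "m + q * P"] by (simp add: algebra_simps)
qed simp

lemma wrap_periodic:
  assumes "\<And>n. z (n + P) = z n + \<kappa>"
  shows "wrap P \<kappa> z = z"
proof
  show "wrap P \<kappa> z n = z n" for n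
    using quasi_periodic_mult[of z P \<kappa> "n mod P" "n div P", OF assms]
    by (simp only: wrap_def mod_div_mult_eq)
qed

text \<open>Tychonoff: the product of the bodies is compact and the length, which involves finitely
  many coordinates, is continuous on it. The product runs over all indices so that a choice of
  vertices is a plain function on \<open>nat\<close>.\<close>

lemma closed_polygon_minimizer:
  fixes S :: "nat \<Rightarrow> 'a::euclidean_space set" and \<kappa> :: 'a and P :: nat
  defines "X \<equiv> wrap P \<kappa>"
  assumes "\<And>n. compact (S n)" "\<And>n. S n \<noteq> {}"
  obtains z where "\<And>n. z n \<in> S n"
    "\<And>y. (\<And>n. y n \<in> S n) \<Longrightarrow>
       (\<Sum>n<P. norm (X z (Suc n) - X z n)) \<le> (\<Sum>n<P. norm (X y (Suc n) - X y n))"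
proof -
  let ?F = "\<lambda>z. \<Sum>n<P. norm (X z (Suc n) - X z n)"
  have "compactin (product_topology (\<lambda>_. euclidean) UNIV) (PiE UNIV S)"
    using assms(2) by (simp add: compactin_PiE)
  then have "compact (PiE UNIV S)"
    by (metis compactin_euclidean_iff euclidean_product_topology)
  moreover have "PiE UNIV S \<noteq> {}" using assms(3) by (simp add: PiE_eq_empty_iff)
  moreover have "continuous_on (PiE UNIV S) ?F"
    unfolding X_def wrap_def
    by (intro continuous_intros continuous_on_subset[OF continuous_on_product_coordinates]) auto
  ultimately obtain z where "z \<in> PiE UNIV S" "\<And>y. y \<in> PiE UNIV S \<Longrightarrow> ?F z \<le> ?F y"
    using continuous_attains_inf[of "PiE UNIV S" ?F] by blast
  then show ?thesis using that[of z] by (auto simp: PiE_iff)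
qed

lemma sum_shift_period:
  fixes h :: "nat \<Rightarrow> 'a::cancel_comm_monoid_add"
  assumes "\<And>n. h (n + P) = h n"
  shows "(\<Sum>n<P. h (m + n)) = (\<Sum>n<P. h n)"
proof (induction m)
  case (Suc m)
  have "(\<Sum>n<P. h (Suc m + n)) + h m = (\<Sum>n<Suc P. h (m + n))"
    by (subst sum.lessThan_Suc_shift) (simp add: add.commute)
  also have "\<dots> = (\<Sum>n<P. h (m + n)) + h m" by (simp add: assms)
  finally show ?case using Suc by simp
qed simp

section \<open>Visible obstacles and connectivity\<close>

lemma lattice_vec_nth [simp]: "lattice_vec k $ a = real_of_int (k $ a)"
  by (simp add: lattice_vec_def)

lemma lattice_vec_zero [simp]: "lattice_vec 0 = 0"
  and lattice_vec_add: "lattice_vec (k + l) = lattice_vec k + lattice_vec l"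
  and lattice_vec_smult: "lattice_vec (int n *s k) = real n *\<^sub>R lattice_vec k"
  by (simp_all add: vec_eq_iff)

lemma torus_proj_lattice [simp]: "torus_proj (x + lattice_vec k) = torus_proj x"
proof -
  have "torus_proj x = range ((\<lambda>l. x + lattice_vec l) \<circ> (+) k)"
    unfolding torus_proj_def image_comp[symmetric] by (simp only: surj_plus)
  then show ?thesis
    by (simp add: torus_proj_def o_def lattice_vec_add add.assoc)
qed

lemma torus_proj_eqD:
  assumes "torus_proj x = torus_proj y"
  obtains k where "x = y + lattice_vec k"
proof -
  have "x \<in> torus_proj x"
    unfolding torus_proj_def by (rule range_eqI[of _ _ 0]) simp
  with assms that show ?thesis by (auto simp: torus_proj_def)
qed

section \<open>Lattice translations of obstacles, visibility and turns\<close>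

definition shift :: "int ^ 'm \<Rightarrow> (int ^ 'm) \<times> nat \<Rightarrow> (int ^ 'm) \<times> nat" where
  "shift k i = (fst i + k, snd i)"

lemma fst_shift [simp]: "fst (shift k i) = fst i + k"
  and snd_shift [simp]: "snd (shift k i) = snd i"
  and shift_zero [simp]: "shift 0 i = i"
  and shift_shift [simp]: "shift k (shift l i) = shift (l + k) i"
  and shift_eq_iff [simp]: "shift k i = shift k j \<longleftrightarrow> i = j"
  by (auto simp: shift_def add.assoc prod_eq_iff)

lemma surj_shift: "surj (shift k)"
  by (rule surjI[of _ "shift (- k)"]) simp

lemma shift_in_indices_iff [simp]: "shift k i \<in> obstacle_indices N \<longleftrightarrow> i \<in> obstacle_indices N"
  by (auto simp: shift_def obstacle_indices_def mem_Times_iff)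

lemma mem_obstacle_iff: "x \<in> obstacle Ob i \<longleftrightarrow> x - lattice_vec (fst i) \<in> base_obstacle Ob (snd i)"
  unfolding obstacle_def by (force simp: image_iff)

lemma obstacle_shift: "obstacle Ob (shift k i) = (+) (lattice_vec k) ` obstacle Ob i"
  by (auto simp: obstacle_def image_image lattice_vec_add add_ac)

lemma obstacle_translation: "obstacle Ob i = (+) (lattice_vec (fst i)) ` base_obstacle Ob (snd i)"
  by (auto simp: obstacle_def add.commute)

lemma mem_obstacle_shift_iff: "x + lattice_vec k \<in> obstacle Ob (shift k i) \<longleftrightarrow> x \<in> obstacle Ob i"
  by (simp add: mem_obstacle_iff lattice_vec_add)

lemma frontier_obstacle_shift_iff:
  "x + lattice_vec k \<in> frontier (obstacle Ob (shift k i)) \<longleftrightarrow> x \<in> frontier (obstacle Ob i)"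
  unfolding obstacle_shift frontier_translation by (auto simp: image_iff add.commute[of x])

lemma obstacle_between_shift_iff:
  "obstacle_between N Ob (shift k l) (shift k i) (shift k j) \<longleftrightarrow> obstacle_between N Ob l i j"
  by (auto simp: obstacle_between_def obstacle_shift convex_hull_translation
      simp flip: image_Un image_Int)

text \<open>The two kinds of turns towards unit translates are certified this way: for each point
  \<open>x\<close> of \<open>C\<close> the hull lies in the open half-space of all \<open>y\<close>
  with \<open>f x < f y\<close>.\<close>

lemma convex_hull_Un_separated:
  fixes f :: "'a::real_vector \<Rightarrow> real"
  assumes "linear f" "\<And>x y. x \<in> C \<Longrightarrow> y \<in> A \<union> B \<Longrightarrow> f x < f y"
  shows "C \<inter> convex hull (A \<union> B) = {}"
proof -
  have "x \<notin> convex hull (A \<union> B)" if "x \<in> C" for x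
  proof -
    have "convex (f -` {f x<..})" by (rule convex_linear_vimage[OF assms(1)]) simp
    moreover have "A \<union> B \<subseteq> f -` {f x<..}" using assms(2)[OF that] by auto
    ultimately have "convex hull (A \<union> B) \<subseteq> f -` {f x<..}" by (rule hull_minimal[rotated])
    then show ?thesis by auto
  qed
  then show ?thesis by auto
qed

definition visible ::
  "nat \<Rightarrow> (nat \<Rightarrow> (real ^ 'm::finite) set set) \<Rightarrow> (int ^ 'm) \<times> nat \<Rightarrow> (int ^ 'm) \<times> nat \<Rightarrow> bool" where
  "visible N Ob i j \<longleftrightarrow> i \<in> obstacle_indices N \<and> j \<in> obstacle_indices N \<and> i \<noteq> j \<and>
     (\<forall>l. \<not> obstacle_between N Ob l i j)"

text \<open>
  An admissible sequence is a walk on the pairs of mutually visible obstacles whose steps are turns.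
  Turning back is always allowed and turns are reversible, so connectivity is an undirected question.
\<close>

definition turn ::
  "nat \<Rightarrow> (nat \<Rightarrow> (real ^ 'm::finite) set set) \<Rightarrow> ((int ^ 'm) \<times> nat) \<times> ((int ^ 'm) \<times> nat) \<Rightarrow>
   ((int ^ 'm) \<times> nat) \<times> ((int ^ 'm) \<times> nat) \<Rightarrow> bool" where
  "turn N Ob s t \<longleftrightarrow> snd s = fst t \<and> visible N Ob (fst s) (snd s) \<and> visible N Ob (fst t) (snd t) \<and>
     \<not> obstacle_between N Ob (snd s) (fst s) (snd t)"

abbreviation shift2 where "shift2 k \<equiv> map_prod (shift k) (shift k)"

lemma visible_commute: "visible N Ob i j \<longleftrightarrow> visible N Ob j i"
  by (auto simp: visible_def obstacle_between_def Un_commute)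

lemma visible_shift_iff [simp]: "visible N Ob (shift k i) (shift k j) \<longleftrightarrow> visible N Ob i j"
proof -
  have "(\<forall>l. \<not> obstacle_between N Ob l (shift k i) (shift k j)) \<longleftrightarrow>
        (\<forall>l. \<not> obstacle_between N Ob (shift k l) (shift k i) (shift k j))"
    by (metis surjD surj_shift)
  then show ?thesis by (simp add: visible_def obstacle_between_shift_iff)
qed

lemma turn_shift2: "turn N Ob s t \<Longrightarrow> turn N Ob (shift2 k s) (shift2 k t)"
  by (auto simp: turn_def obstacle_between_shift_iff)

lemma turn_reverse: "turn N Ob (i, j) (j, l) \<Longrightarrow> turn N Ob (l, j) (j, i)"
  by (auto simp: turn_def visible_commute obstacle_between_def Un_commute)

section \<open>Visibility and turns under the standing assumptions\<close>

locale torus_obstacles =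
  fixes N :: nat and Ob :: "nat \<Rightarrow> (real ^ 'm::finite) set set"
  assumes dim_ge_2: "2 \<le> CARD('m)"
    and base_in_box: "r \<in> {1..N} \<Longrightarrow> base_obstacle Ob r \<subseteq> box 0 1"
    and base_body: "r \<in> {1..N} \<Longrightarrow> strictly_convex_body (base_obstacle Ob r)"
    and base_C2: "r \<in> {1..N} \<Longrightarrow> C2_boundary (base_obstacle Ob r)"
    and base_diameter: "r \<in> {1..N} \<Longrightarrow> diameter (base_obstacle Ob r) < sqrt 2 / 4"
    and base_projections: "r \<in> {1..N} \<Longrightarrow> s \<in> {1..N} \<Longrightarrow> r \<noteq> s \<Longrightarrow>
      (\<lambda>x. x $ a) ` base_obstacle Ob r \<inter> (\<lambda>x. x $ a) ` base_obstacle Ob s = {}"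
    and base_no_eclipse: "r \<in> {1..N} \<Longrightarrow> s \<in> {1..N} \<Longrightarrow> t \<in> {1..N} \<Longrightarrow>
      r \<noteq> s \<Longrightarrow> r \<noteq> t \<Longrightarrow> s \<noteq> t \<Longrightarrow>
      convex hull (base_obstacle Ob r \<union> base_obstacle Ob s) \<inter> base_obstacle Ob t = {}"
begin

abbreviation I where "I \<equiv> obstacle_indices N :: ((int ^ 'm) \<times> nat) set"
abbreviation B where "B \<equiv> base_obstacle Ob"
abbreviation obs where "obs \<equiv> obstacle Ob"
abbreviation between where "between \<equiv> obstacle_between N Ob"
abbreviation vis where "vis \<equiv> visible N Ob"
abbreviation trn where "trn \<equiv> turn N Ob"

lemma index_range: "i \<in> I \<longleftrightarrow> snd i \<in> {1..N}"
  by (auto simp: obstacle_indices_def mem_Times_iff)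

lemma other_coordinate: obtains b :: 'm where "b \<noteq> a"
proof -
  have "UNIV \<noteq> {a}"
  proof
    assume "UNIV = {a}"
    then have "CARD('m) = card {a}" by (rule arg_cong)
    with dim_ge_2 show False by simp
  qed
  then show ?thesis using that by blast
qed

lemma base_convex: "r \<in> {1..N} \<Longrightarrow> convex (B r)"
  using base_body[of r] interior_subset
  unfolding strictly_convex_body_def convex_contains_open_segment by (metis open_segment_idem empty_subsetI subset_trans)

lemma base_compact: "r \<in> {1..N} \<Longrightarrow> compact (B r)"
  and base_nonempty: "r \<in> {1..N} \<Longrightarrow> B r \<noteq> {}"
  using base_body[of r] by (auto simp: strictly_convex_body_def)

lemma obstacle_convex: "i \<in> I \<Longrightarrow> convex (obs i)"
  and obstacle_compact: "i \<in> I \<Longrightarrow> compact (obs i)"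
  and obstacle_nonempty: "i \<in> I \<Longrightarrow> obs i \<noteq> {}"
  using base_convex base_compact base_nonempty
  by (simp_all add: obstacle_translation index_range convex_translation compact_translation)

lemma obstacle_coordinate:
  assumes "i \<in> I" "x \<in> obs i"
  shows "real_of_int (fst i $ a) < x $ a" "x $ a < real_of_int (fst i $ a) + 1"
proof -
  have "x - lattice_vec (fst i) \<in> box 0 1"
    using base_in_box[of "snd i"] assms by (auto simp: mem_obstacle_iff index_range)
  then show "real_of_int (fst i $ a) < x $ a" "x $ a < real_of_int (fst i $ a) + 1"
    by (auto simp: mem_box_cart less_diff_eq algebra_simps dest!: spec[of _ a])
qed

lemma obstacle_floor: "i \<in> I \<Longrightarrow> x \<in> obs i \<Longrightarrow> \<lfloor>x $ a\<rfloor> = fst i $ a"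
  using obstacle_coordinate[of i x a] by (simp add: floor_eq_iff)

text \<open>Equal coordinates have equal floors, so both obstacles lie in the same layer of cubes,
  and the disjointness of projections in the base cube applies. A single coordinate thus determines
  the label \<open>snd i\<close>, whatever the position in the other directions.\<close>

lemma obstacle_projections:
  assumes "i \<in> I" "j \<in> I" "x \<in> obs i" "y \<in> obs j" "x $ a = y $ a"
  shows "snd i = snd j"
proof (rule ccontr)
  assume "snd i \<noteq> snd j"
  have "fst i $ a = fst j $ a" using obstacle_floor assms by metis
  with assms(5) have "(x - lattice_vec (fst i)) $ a = (y - lattice_vec (fst j)) $ a" by simp
  moreover have "(x - lattice_vec (fst i)) $ a \<in> (\<lambda>x. x $ a) ` B (snd i)"
    "(y - lattice_vec (fst j)) $ a \<in> (\<lambda>x. x $ a) ` B (snd j)"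
    using assms(3,4) unfolding mem_obstacle_iff by (blast intro: image_eqI)+
  ultimately show False
    using base_projections[of "snd i" "snd j" a] \<open>snd i \<noteq> snd j\<close> assms(1,2)
    unfolding index_range by (metis disjoint_iff)
qed

lemma obstacle_unique:
  assumes "i \<in> I" "j \<in> I" "x \<in> obs i" "x \<in> obs j"
  shows "i = j"
  using obstacle_projections[OF assms refl] obstacle_floor assms by (metis prod_eq_iff vec_eq_iff)

lemma obstacle_norm_diff_le:
  assumes "i \<in> I" "x \<in> obs i"
  shows "norm (x - lattice_vec (fst i)) \<le> real CARD('m)"
proof -
  have "norm (x - lattice_vec (fst i)) \<le> (\<Sum>a\<in>UNIV. \<bar>(x - lattice_vec (fst i)) $ a\<bar>)"
    by (rule norm_le_l1_cart)
  also have "\<dots> \<le> (\<Sum>a\<in>(UNIV :: 'm set). 1)"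
  proof (rule sum_mono)
    fix a show "\<bar>(x - lattice_vec (fst i)) $ a\<bar> \<le> 1"
      using obstacle_coordinate[OF assms, of a] by (simp add: abs_le_iff)
  qed
  finally show ?thesis by simp
qed

text \<open>This is how the diameter bound enters: sqrt 2 / 4 is below 1/2, so two such variations
  together stay below a unit translation.\<close>

lemma obstacle_coordinate_diff:
  assumes "i \<in> I" "x \<in> obs i" "y \<in> obs i"
  shows "x $ a < y $ a + 1 / 2"
proof -
  have "sqrt 2 / 4 < 1 / (2 :: real)" using real_sqrt_less_mono[of 2 4] by simp
  moreover have "dist (x - lattice_vec (fst i)) (y - lattice_vec (fst i)) \<le> diameter (B (snd i))"
    using assms base_compact[of "snd i"]
    by (intro diameter_bounded_bound) (auto simp: mem_obstacle_iff index_range compact_imp_bounded)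
  moreover have "x $ a - y $ a \<le> dist x y"
    using component_le_norm_cart[of "x - y" a] by (simp add: dist_norm)
  ultimately show ?thesis using base_diameter[of "snd i"] assms(1) by (simp add: index_range dist_norm)
qed

text \<open>The hull of an obstacle with itself is the obstacle, which is disjoint from
  \<open>obs j\<close>.\<close>

lemma turn_back:
  assumes "vis i j"
  shows "trn (i, j) (j, i)"
proof -
  have "obs j \<inter> obs i = {}" "convex hull (obs i \<union> obs i) = obs i"
    using assms obstacle_unique[of i j] by (auto simp: visible_def hull_same obstacle_convex)
  then show ?thesis
    using assms by (simp add: turn_def obstacle_between_def visible_commute[of _ _ j])
qed

text \<open>In every coordinate \<open>b \<noteq> a\<close> the hull has the same projection as
  \<open>obs i\<close>. Any obstacle meeting it therefore has the label of \<open>i\<close> and its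
  cube agrees with that of \<open>i\<close> in all these coordinates; only the position along
  \<open>a\<close> is left to determine.\<close>

lemma visible_unit_step: "i \<in> I \<Longrightarrow> vis i (shift (axis a 1) i)"
proof -
  assume i: "i \<in> I"
  let ?j = "shift (axis a 1) i"
  have "l = i \<or> l = ?j" if l: "l \<in> I" and y: "y \<in> obs l" "y \<in> convex hull (obs i \<union> obs ?j)" for l y
  proof -
    have other: "y $ b \<in> (\<lambda>x. x $ b) ` obs i" if "b \<noteq> a" for b
    proof -
      have "linear (\<lambda>x :: real ^ 'm. x $ b)" by (simp add: linear_iff)
      then have "convex ((\<lambda>x. x $ b) -` (\<lambda>x. x $ b) ` obs i)"
        by (intro convex_linear_vimage convex_linear_image obstacle_convex i)
      moreover have "obs i \<union> obs ?j \<subseteq> (\<lambda>x. x $ b) -` (\<lambda>x. x $ b) ` obs i"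
        using that by (auto simp: obstacle_shift axis_def)
      ultimately have "convex hull (obs i \<union> obs ?j) \<subseteq> (\<lambda>x. x $ b) -` (\<lambda>x. x $ b) ` obs i"
        by (rule hull_minimal[rotated])
      with y show ?thesis by auto
    qed
    have other_eq: "fst l $ b = fst i $ b" "snd l = snd i" if "b \<noteq> a" for b
    proof -
      from other[OF that] obtain x where x: "x \<in> obs i" "y $ b = x $ b" by auto
      show "snd l = snd i" by (rule obstacle_projections[OF l i y(1) x])
      show "fst l $ b = fst i $ b"
        using obstacle_floor[OF l y(1), of b] obstacle_floor[OF i x(1), of b] x(2) by simp
    qed
    \<comment> \<open>In direction \<open>a\<close> the hull stays within the two cubes of
      \<open>i\<close> and its translate.\<close>
    let ?H = "{y. real_of_int (fst i $ a) < y $ a} \<inter> {y. y $ a < real_of_int (fst i $ a) + 2}"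
    have "convex ?H"
      using convex_halfspace_gt[of "real_of_int (fst i $ a)" "axis a 1 :: real ^ 'm"]
        convex_halfspace_lt[of "axis a 1 :: real ^ 'm" "real_of_int (fst i $ a) + 2"]
      by (intro convex_Int) (simp_all add: inner_axis' )
    moreover have "obs i \<union> obs ?j \<subseteq> ?H"
      using obstacle_coordinate[OF i, of _ a] by (fastforce simp: obstacle_shift axis_def)
    ultimately have "y \<in> ?H" using y(2) hull_minimal by blast
    then have "fst l $ a = fst i $ a \<or> fst l $ a = fst i $ a + 1"
      using obstacle_coordinate[OF l y(1), of a] by (auto; linarith)
    moreover obtain b :: 'm where "b \<noteq> a" by (rule other_coordinate)
    ultimately consider "fst l $ a = fst i $ a" "b \<noteq> a" | "fst l $ a = fst i $ a + 1" "b \<noteq> a"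
      by auto
    then show ?thesis
    proof cases
      case 1
      then have "fst l $ c = fst i $ c" for c using other_eq(1)[of c] by (cases "c = a") auto
      then show ?thesis using other_eq(2)[OF 1(2)] by (simp add: prod_eq_iff vec_eq_iff)
    next
      case 2
      then have "fst l $ c = fst ?j $ c" for c
        using other_eq(1)[of c] by (cases "c = a") (auto simp: axis_def)
      then show ?thesis using other_eq(2)[OF 2(2)] by (simp add: prod_eq_iff vec_eq_iff)
    qed
  qed
  moreover have "i \<noteq> ?j" by (auto simp: prod_eq_iff vec_eq_iff axis_def)
  ultimately show ?thesis
    using i by (auto simp: visible_def obstacle_between_def)
qed

definition unit_vectors :: "(int ^ 'm) set" where
  "unit_vectors = {axis a c | a c. c = 1 \<or> c = - 1}"

lemma visible_unit: "vis i (shift e i)" if "i \<in> I" "e \<in> unit_vectors"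
proof -
  from that(2) obtain a c where e: "e = axis a c" "c = 1 \<or> c = - 1"
    by (auto simp: unit_vectors_def)
  from e(2) show ?thesis
  proof
    assume "c = - 1"
    moreover have "axis a (- 1) + axis a 1 = (0 :: int ^ 'm)" by (simp add: vec_eq_iff axis_def)
    ultimately show ?thesis
      using visible_unit_step[of "shift e i" a] that(1) e(1) by (simp add: visible_commute)
  qed (use visible_unit_step that(1) e(1) in simp)
qed

text \<open>The functional \<open>f\<close> is chosen so that either translation raises it by
  exactly 1, while on \<open>obs i\<close> it varies by less than 1/2 + 1/2. Hence it is larger on
  both translates than anywhere on \<open>obs i\<close>.\<close>

lemma turn_unit_unit:
  assumes "i \<in> I" "a \<noteq> b" "c = 1 \<or> c = - 1" "d = 1 \<or> d = - 1"
  shows "trn (shift (axis a c) i, i) (i, shift (axis b d) i)"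
proof -
  define f where "f x = real_of_int c * x $ a + real_of_int d * x $ b" for x :: "real ^ 'm"
  have "linear f" by (simp add: f_def linear_iff algebra_simps)
  moreover have "f x < f y"
    if x: "x \<in> obs i" and y: "y \<in> obs (shift (axis a c) i) \<union> obs (shift (axis b d) i)" for x y
  proof -
    from y obtain x' where x': "x' \<in> obs i"
      and "y = lattice_vec (axis a c) + x' \<or> y = lattice_vec (axis b d) + x'"
      by (auto simp: obstacle_shift)
    then have "f y = f x' + 1"
      using assms(2-4) by (auto simp: f_def axis_def algebra_simps)
    moreover have "real_of_int c * x $ a < real_of_int c * x' $ a + 1 / 2"
      "real_of_int d * x $ b < real_of_int d * x' $ b + 1 / 2"
      using obstacle_coordinate_diff[OF assms(1) x x', of a] obstacle_coordinate_diff[OF assms(1) x' x, of a]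
        obstacle_coordinate_diff[OF assms(1) x x', of b] obstacle_coordinate_diff[OF assms(1) x' x, of b]
        assms(3,4) by auto
    ultimately show ?thesis unfolding f_def by linarith
  qed
  ultimately have "obs i \<inter> convex hull (obs (shift (axis a c) i) \<union> obs (shift (axis b d) i)) = {}"
    by (rule convex_hull_Un_separated)
  moreover have "axis a c \<in> unit_vectors" "axis b d \<in> unit_vectors"
    using assms(3,4) by (auto simp: unit_vectors_def)
  ultimately show ?thesis
    using assms(1) visible_unit
    by (simp add: turn_def obstacle_between_def visible_commute[of _ _ "shift _ i"])
qed

text \<open>In distinct cubes some integer coordinate separates the obstacles; in the same cube the
  projections to any coordinate are disjoint intervals. The sign \<open>c\<close> records on which
  side \<open>obs i\<close> lies.\<close>

lemma coordinate_separation: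
  assumes "i \<in> I" "j \<in> I" "i \<noteq> j"
  obtains a c where "c = 1 \<or> c = - 1"
    "\<And>x y. x \<in> obs j \<Longrightarrow> y \<in> obs i \<Longrightarrow> real_of_int c * x $ a < real_of_int c * y $ a"
proof (cases "fst i = fst j")
  case False
  then obtain a where "fst i $ a \<noteq> fst j $ a" by (auto simp: vec_eq_iff)
  then consider "fst i $ a + 1 \<le> fst j $ a" | "fst j $ a + 1 \<le> fst i $ a" by linarith
  then show ?thesis
  proof cases
    case 1
    have "real_of_int (- 1) * x $ a < real_of_int (- 1) * y $ a" if "x \<in> obs j" "y \<in> obs i" for x y
      using obstacle_coordinate[OF assms(1) that(2), of a] obstacle_coordinate[OF assms(2) that(1), of a] 1
      by linarith
    with that[of "- 1" a] show ?thesis by auto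
  next
    case 2
    have "real_of_int 1 * x $ a < real_of_int 1 * y $ a" if "x \<in> obs j" "y \<in> obs i" for x y
      using obstacle_coordinate[OF assms(1) that(2), of a] obstacle_coordinate[OF assms(2) that(1), of a] 2
      by linarith
    with that[of 1 a] show ?thesis by auto
  qed
next
  case True
  with assms(3) have snd_ne: "snd i \<noteq> snd j" by (auto simp: prod_eq_iff)
  fix a :: 'm
  \<comment> \<open>The coordinate differences form a convex set of reals, hence an interval; it
    misses 0 and so has constant sign.\<close>
  define D where "D = (\<lambda>z. z $ a) ` (\<Union>y\<in>obs i. \<Union>x\<in>obs j. {y - x})"
  have "linear (\<lambda>z :: real ^ 'm. z $ a)" by (simp add: linear_iff)
  then have "convex D"
    unfolding D_def by (intro convex_linear_image convex_differences obstacle_convex assms)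
  then have "is_interval D" by (simp add: is_interval_convex_1)
  moreover have "0 \<notin> D"
    using obstacle_projections[OF assms(1,2)] snd_ne by (auto simp: D_def)
  ultimately have "(\<forall>d\<in>D. 0 < d) \<or> (\<forall>d\<in>D. d < 0)"
    by (metis mem_is_interval_1_I linorder_not_less)
  then show ?thesis
  proof
    assume "\<forall>d\<in>D. 0 < d"
    then have "real_of_int 1 * x $ a < real_of_int 1 * y $ a" if "x \<in> obs j" "y \<in> obs i" for x y
      using that by (force simp: D_def)
    with that[of 1 a] show ?thesis by auto
  next
    assume "\<forall>d\<in>D. d < 0"
    then have "real_of_int (- 1) * x $ a < real_of_int (- 1) * y $ a" if "x \<in> obs j" "y \<in> obs i" for x y
      using that by (force simp: D_def)
    with that[of "- 1" a] show ?thesis by auto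
  qed
qed

text \<open>The unit translate is taken in the coordinate direction in which \<open>obs i\<close>
  already lies beyond \<open>obs j\<close>. One signed coordinate then separates
  \<open>obs j\<close> from both, as a unit step exceeds the variation 1/2.\<close>

lemma turn_to_unit:
  assumes "vis i j"
  obtains e where "e \<in> unit_vectors" "trn (i, j) (j, shift e j)"
proof -
  have ij: "i \<in> I" "j \<in> I" "i \<noteq> j" using assms by (auto simp: visible_def)
  from ij obtain a c where c: "c = 1 \<or> c = - 1"
    and sep: "\<And>x y. x \<in> obs j \<Longrightarrow> y \<in> obs i \<Longrightarrow> real_of_int c * x $ a < real_of_int c * y $ a"
    by (rule coordinate_separation) blast
  let ?e = "axis a c"
  have "obs j \<inter> convex hull (obs i \<union> obs (shift ?e j)) = {}"
  proof (rule convex_hull_Un_separated)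
    show "linear (\<lambda>z :: real ^ 'm. real_of_int c * z $ a)" by (simp add: linear_iff algebra_simps)
    show "real_of_int c * x $ a < real_of_int c * y $ a"
      if x: "x \<in> obs j" and y: "y \<in> obs i \<union> obs (shift ?e j)" for x y
      using y
    proof
      assume "y \<in> obs (shift ?e j)"
      then obtain x' where x': "x' \<in> obs j" "y = lattice_vec ?e + x'"
        by (auto simp: obstacle_shift)
      with c obstacle_coordinate_diff[OF ij(2) x x'(1), of a]
        obstacle_coordinate_diff[OF ij(2) x'(1) x, of a] show ?thesis
        by (auto simp: axis_def)
    qed (rule sep[OF x])
  qed
  moreover have "?e \<in> unit_vectors" using c by (auto simp: unit_vectors_def)
  ultimately show ?thesis
    using that[of ?e] assms visible_unit[OF ij(2), of ?e]
    by (simp add: turn_def obstacle_between_def)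
qed

text \<open>The hull of two obstacles of a cube stays in the open cube, so only obstacles of that
  cube can meet it, and those are excluded by no-eclipse.\<close>

lemma visible_same_cube:
  assumes "i \<in> I" "j \<in> I" "fst i = fst j" "i \<noteq> j"
  shows "vis i j"
proof -
  have *: "vis (0, r) (0, s)" if rs: "r \<in> {1..N}" "s \<in> {1..N}" "r \<noteq> s" for r s
  proof -
    have "l = (0, r) \<or> l = (0, s)"
      if l: "l \<in> I" and y: "y \<in> obs l" "y \<in> convex hull (obs (0, r) \<union> obs (0, s))" for l y
    proof -
      have hull: "y \<in> convex hull (B r \<union> B s)" using y(2) by (simp add: obstacle_translation)
      also have "\<dots> \<subseteq> box 0 1"
        using base_in_box rs(1,2) by (intro hull_minimal) auto
      finally have "0 < y $ a \<and> y $ a < 1" for a by (auto simp: mem_box_cart)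
      then have "fst l $ a = 0" for a
        using obstacle_floor[OF l y(1), of a] by (metis floor_unique of_int_0 less_imp_le add_0)
      then have "fst l = 0" by (simp add: vec_eq_iff)
      moreover from this have "y \<in> B (snd l)" using y(1) by (simp add: mem_obstacle_iff)
      ultimately show ?thesis
        using base_no_eclipse[OF rs(1,2), of "snd l"] rs(3) hull l by (auto simp: index_range prod_eq_iff)
    qed
    then have "\<not> between l (0, r) (0, s)" for l
      unfolding obstacle_between_def by blast
    with rs show ?thesis by (simp add: visible_def index_range)
  qed
  have "shift (fst i) (0, snd i) = i" "shift (fst i) (0, snd j) = j"
    using assms(3) by (simp_all add: shift_def prod_eq_iff)
  moreover have "vis (0, snd i) (0, snd j)"
    using * assms by (simp add: index_range prod_eq_iff)
  ultimately show ?thesis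
    using visible_shift_iff[of N Ob "fst i" "(0, snd i)" "(0, snd j)"] by simp
qed

text \<open>The neighbours of \<open>j\<close>, with \<open>E\<close> linking those joined by a turn
  at \<open>j\<close>, form a connected graph: each is linked to some unit translate of
  \<open>j\<close>, and the unit translates are linked to each other.\<close>

lemma reach_around:
  assumes "vis i j" "vis j l"
  shows "trn\<^sup>*\<^sup>* (i, j) (j, l)"
proof -
  define E where "E i l \<longleftrightarrow> trn (i, j) (j, l)" for i l
  \<comment> \<open>A path in \<open>E\<close> becomes a walk that returns to \<open>j\<close>
    between its edges: having arrived at \<open>l\<close>, turn back to \<open>j\<close>, then turn
    at \<open>j\<close> from \<open>l\<close> to \<open>l'\<close>.\<close>
  have E_walk: "trn\<^sup>*\<^sup>* (i, j) (j, l)" if "E\<^sup>*\<^sup>* i l" "vis i j" for i l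
    using that
  proof induction
    case base
    then show ?case using turn_back by blast
  next
    case (step l l')
    then have "trn (l, j) (j, l')" by (simp add: E_def)
    moreover from this have "trn (j, l) (l, j)"
      by (intro turn_back) (simp add: turn_def visible_commute)
    ultimately show ?case using step.IH[OF step.prems] by (meson rtranclp.rtrancl_into_rtrancl)
  qed
  have j: "j \<in> I" using assms by (simp add: visible_def)
  have E_sym: "E i l \<Longrightarrow> E l i" for i l unfolding E_def by (rule turn_reverse)
  have units: "E\<^sup>*\<^sup>* (shift e j) (shift e' j)" if e: "e \<in> unit_vectors" "e' \<in> unit_vectors" for e e'
  proof -
    obtain a c where a: "e = axis a c" "c = 1 \<or> c = - 1" using e by (auto simp: unit_vectors_def)
    obtain b d where b: "e' = axis b d" "d = 1 \<or> d = - 1" using e by (auto simp: unit_vectors_def)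
    show ?thesis
    proof (cases "a = b")
      \<comment> \<open>Equal or opposite directions admit no direct application of
        \<open>turn_unit_unit\<close>; a translate along a second axis is linked to both.\<close>
      case True
      obtain a' where "a' \<noteq> a" by (rule other_coordinate)
      then have "E (shift e j) (shift (axis a' 1) j)" "E (shift (axis a' 1) j) (shift e' j)"
        using turn_unit_unit[OF j] a b True by (auto simp: E_def)
      then show ?thesis by (meson converse_rtranclp_into_rtranclp r_into_rtranclp)
    next
      case False
      then have "E (shift e j) (shift e' j)" using turn_unit_unit[OF j] a b by (auto simp: E_def)
      then show ?thesis by blast
    qed
  qed
  obtain e where e: "e \<in> unit_vectors" "E i (shift e j)"
    using turn_to_unit[OF assms(1)] unfolding E_def by blast
  obtain e' where e': "e' \<in> unit_vectors" "E l (shift e' j)"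
    using turn_to_unit[of l j] assms(2) unfolding E_def by (metis visible_commute)
  have "E\<^sup>*\<^sup>* i l"
    using e(2) units[OF e(1) e'(1)] E_sym[OF e'(2)]
    by (meson converse_rtranclp_into_rtranclp rtranclp.rtrancl_into_rtrancl)
  from E_walk[OF this assms(1)] show ?thesis .
qed

text \<open>Distinct obstacles of one cube see each other, so a walk around \<open>j\<close> can be
  made to end by going to \<open>i'\<close>, and a walk around \<open>i'\<close> continues from
  there.\<close>

lemma reach_same_cube:
  assumes "vis i j" "vis i' j'" "fst j = fst i'"
  shows "trn\<^sup>*\<^sup>* (i, j) (i', j')"
proof (cases "j = i'")
  case True
  with assms reach_around show ?thesis by blast
next
  case False
  then have "vis j i'" using assms by (intro visible_same_cube) (auto simp: visible_def)
  with assms reach_around show ?thesis by (meson rtranclp_trans)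
qed

end

section \<open>From walks of turns to periodic admissible sequences\<close>

lemma turn_admissible_infinite:
  assumes "fst (K 0) = 0" "\<And>n. turn N Ob (K n, K (Suc n)) (K (Suc n), K (Suc (Suc n)))"
  shows "admissible_sequence N Ob K \<infinity>"
  using assms by (auto simp: admissible_sequence_def turn_def visible_def) metis

lemma admissible_visible:
  "admissible_sequence N Ob K p \<Longrightarrow> enat n < p \<Longrightarrow> visible N Ob (K n) (K (Suc n))"
  by (auto simp: admissible_sequence_def visible_def Suc_ile_eq)

lemma admissible_turn:
  assumes "admissible_sequence N Ob K p" "enat (Suc n) < p"
  shows "turn N Ob (K n, K (Suc n)) (K (Suc n), K (Suc (Suc n)))"
proof -
  have "enat n < p" using assms(2) by (meson enat_ord_simps(2) lessI order.strict_trans)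
  with assms show ?thesis
    by (auto simp: turn_def admissible_visible) (auto simp: admissible_sequence_def)
qed

lemma shift2_zero [simp]: "shift2 0 s = s"
  and shift2_shift2 [simp]: "shift2 k (shift2 l s) = shift2 (l + k) s"
  by (cases s; simp)+

text \<open>The walk is repeated in blocks of length \<open>P\<close>, block \<open>m div P\<close>
  being translated by that multiple of \<open>\<kappa>\<close>. At a seam, the final state
  \<open>g P\<close> is the first state of the next block.\<close>

lemma periodic_turn_walk:
  fixes g :: "nat \<Rightarrow> ((int ^ 'm::finite) \<times> nat) \<times> ((int ^ 'm) \<times> nat)"
  assumes "\<And>m. m < P \<Longrightarrow> turn N Ob (g m) (g (Suc m))" "g P = shift2 \<kappa> (g 0)" "0 < P"
  obtains G where "\<And>m. m \<le> P \<Longrightarrow> G m = g m" "\<And>m. G (m + P) = shift2 \<kappa> (G m)"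
    "\<And>m. turn N Ob (G m) (G (Suc m))"
proof -
  define G where "G m = shift2 (int (m div P) *s \<kappa>) (g (m mod P))" for m
  have smult: "int (Suc n) *s \<kappa> = int n *s \<kappa> + \<kappa>" for n
    by (simp add: vec_eq_iff algebra_simps)
  have "G m = g m" if "m \<le> P" for m
    using that assms(2,3) by (cases "m = P") (auto simp: G_def)
  moreover have "G (m + P) = shift2 \<kappa> (G m)" for m
    using assms(3) smult[of "m div P"] by (simp add: G_def add.commute)
  moreover have "turn N Ob (G m) (G (Suc m))" for m
  proof -
    have "G (Suc m) = shift2 (int (m div P) *s \<kappa>) (g (Suc (m mod P)))"
    proof (cases "Suc (m mod P) = P")
      case True
      then have "Suc m mod P = 0" "Suc m div P = Suc (m div P)" by (simp_all add: mod_Suc div_Suc)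
      with True assms(2) smult[of "m div P"] show ?thesis
        by (simp add: G_def add.commute)
    next
      case False
      with assms(3) show ?thesis by (simp add: G_def mod_Suc div_Suc)
    qed
    moreover have "turn N Ob (g (m mod P)) (g (Suc (m mod P)))" using assms(1,3) by simp
    ultimately show ?thesis using turn_shift2 by (simp add: G_def)
  qed
  ultimately show ?thesis by (rule that)
qed

text \<open>A bound for the distance between points of two obstacles in terms of their cubes alone,
  each obstacle lying within \<open>CARD('m)\<close> of the corner of its cube. It prices connecting
  walks before any vertices are chosen, and is translation invariant.\<close>

definition jump_bound :: "((int ^ 'm::finite) \<times> nat) \<times> ((int ^ 'm) \<times> nat) \<Rightarrow> real" where
  "jump_bound s =
     norm (lattice_vec (fst (snd s)) - lattice_vec (fst (fst s))) + 2 * real CARD('m)"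

lemma jump_bound_nonneg: "0 \<le> jump_bound s"
  by (simp add: jump_bound_def)

lemma jump_bound_shift2 [simp]: "jump_bound (shift2 k s) = jump_bound s"
  by (cases s) (simp add: jump_bound_def lattice_vec_add)

context torus_obstacles
begin

lemma norm_diff_le_jump_bound:
  assumes "i \<in> I" "j \<in> I" "x \<in> obs i" "y \<in> obs j"
  shows "norm (y - x) \<le> jump_bound (i, j)"
proof -
  have "y - x = (lattice_vec (fst j) - lattice_vec (fst i)) + ((y - lattice_vec (fst j)) - (x - lattice_vec (fst i)))"
    by simp
  also have "norm \<dots> \<le> norm (lattice_vec (fst j) - lattice_vec (fst i))
      + (norm (y - lattice_vec (fst j)) + norm (x - lattice_vec (fst i)))"
    by (intro norm_triangle_mono norm_triangle_ineq4 order_refl)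
  finally show ?thesis
    using obstacle_norm_diff_le[OF assms(1,3)] obstacle_norm_diff_le[OF assms(2,4)]
    by (simp add: jump_bound_def)
qed

lemma finite_unit_vectors: "finite unit_vectors"
proof -
  have "unit_vectors \<subseteq> (\<lambda>(a, c). axis a c) ` (UNIV \<times> {1, - 1})"
    by (auto simp: unit_vectors_def image_iff)
  then show ?thesis by (rule finite_subset) simp
qed

text \<open>
  By translation invariance it suffices to connect the finitely many pairs consisting of an
  obstacle in the unit cube and one of its neighbouring copies.
\<close>

lemma bounded_connection:
  obtains C where "\<And>i j i' j'. vis i j \<Longrightarrow> vis i' j' \<Longrightarrow>
    \<exists>n f. trn (i, j) (f 0) \<and> (\<forall>m<n. trn (f m) (f (Suc m))) \<and>
      trn (f n) (shift2 (fst j - fst i') (i', j')) \<and> (\<Sum>m\<le>n. jump_bound (f m)) \<le> C"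
proof -
  \<comment> \<open>A query \<open>(r, e, r', e')\<close> asks for a walk that leaves obstacle
    \<open>r\<close> of the base cube for its translate by \<open>e\<close> and finally enters
    obstacle \<open>r'\<close> of the same cube from its translate by \<open>e'\<close>.\<close>
  define Q where "Q = {1..N} \<times> unit_vectors \<times> {1..N} \<times> unit_vectors"
  define start where "start = (\<lambda>(r, e :: int ^ 'm, r' :: nat, e' :: int ^ 'm). ((0 :: int ^ 'm, r :: nat), shift e (0, r)))"
  define goal where "goal = (\<lambda>(r :: nat, e :: int ^ 'm, r' :: nat, e' :: int ^ 'm). (shift e' (0, r'), (0 :: int ^ 'm, r')))"
  have "\<exists>n f. f 0 = start q \<and> f n = goal q \<and> (\<forall>m<n. trn (f m) (f (Suc m)))" if "q \<in> Q" for q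
  proof -
    obtain r e r' e' where q: "q = (r, e, r', e')" by (cases q)
    with that have mem: "(0, r) \<in> I" "(0, r') \<in> I" "e \<in> unit_vectors" "e' \<in> unit_vectors"
      by (auto simp: Q_def index_range)
    have "trn ((0, r), shift e (0, r)) (shift e (0, r), (0, r))"
      by (intro turn_back visible_unit mem)
    moreover have "trn\<^sup>*\<^sup>* (shift e (0, r), (0, r)) ((0, r'), shift e' (0, r'))"
      using visible_unit[OF mem(1,3)] visible_unit[OF mem(2,4)]
      by (intro reach_same_cube) (simp_all add: visible_commute)
    moreover have "trn ((0, r'), shift e' (0, r')) (shift e' (0, r'), (0, r'))"
      by (intro turn_back visible_unit mem)
    ultimately have "trn\<^sup>*\<^sup>* (start q) (goal q)"
      unfolding start_def goal_def q prod.case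
      by (meson converse_rtranclp_into_rtranclp rtranclp.rtrancl_into_rtrancl)
    then show ?thesis unfolding rtranclp_power relpowp_fun_conv by blast
  qed
  then have "\<forall>q\<in>Q. \<exists>n f. f 0 = start q \<and> f n = goal q \<and> (\<forall>m<n. trn (f m) (f (Suc m)))"
    by blast
  from bchoice[OF this] obtain len where
    "\<forall>q\<in>Q. \<exists>f. f 0 = start q \<and> f (len q) = goal q \<and> (\<forall>m<len q. trn (f m) (f (Suc m)))" ..
  from bchoice[OF this] obtain w where w: "\<And>q. q \<in> Q \<Longrightarrow> w q 0 = start q"
    "\<And>q. q \<in> Q \<Longrightarrow> w q (len q) = goal q"
    "\<And>q m. q \<in> Q \<Longrightarrow> m < len q \<Longrightarrow> trn (w q m) (w q (Suc m))"
    by blast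
  define cost where "cost q = (\<Sum>m\<le>len q. jump_bound (w q m))" for q
  have "finite Q" using finite_unit_vectors by (simp add: Q_def)
  show ?thesis
  \<comment> \<open>Costs are nonnegative, so the sum over the finite set \<open>Q\<close> bounds
    the cost of each single query.\<close>
  proof (rule that[of "\<Sum>q\<in>Q. cost q"])
    fix i j i' j' assume vis: "vis i j" "vis i' j'"
    obtain e where e: "e \<in> unit_vectors" "trn (i, j) (j, shift e j)"
      using turn_to_unit[OF vis(1)] by blast
    \<comment> \<open>Turns are reversible: a turn from \<open>(j', i')\<close> to a unit translate,
      read backwards, enters \<open>(i', j')\<close> from that translate.\<close>
    obtain e' where e': "e' \<in> unit_vectors" "trn (j', i') (i', shift e' i')"
      using turn_to_unit[of j' i'] vis(2) visible_commute by metis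
    define q where "q = (snd j, e, snd i', e')"
    have q: "q \<in> Q" using e e' vis by (auto simp: Q_def q_def visible_def index_range)
    define f where "f m = shift2 (fst j) (w q m)" for m
    have "f 0 = (j, shift e j)"
      using w(1)[OF q] by (simp add: f_def start_def q_def shift_def add.commute)
    moreover have "f (len q) = shift2 (fst j - fst i') (shift e' i', i')"
      using w(2)[OF q] by (simp add: f_def goal_def q_def shift_def add.commute)
    moreover have "trn (shift2 (fst j - fst i') (shift e' i', i')) (shift2 (fst j - fst i') (i', j'))"
      by (rule turn_shift2[OF turn_reverse[OF e'(2)]])
    moreover have "trn (f m) (f (Suc m))" if "m < len q" for m
      unfolding f_def by (rule turn_shift2[OF w(3)[OF q that]])
    moreover have "(\<Sum>m\<le>len q. jump_bound (f m)) \<le> (\<Sum>q\<in>Q. cost q)"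
      using member_le_sum[OF q, of cost] \<open>finite Q\<close>
      by (simp add: f_def cost_def sum_nonneg jump_bound_nonneg)
    ultimately show "\<exists>n f. trn (i, j) (f 0) \<and> (\<forall>m<n. trn (f m) (f (Suc m))) \<and>
      trn (f n) (shift2 (fst j - fst i') (i', j')) \<and> (\<Sum>m\<le>n. jump_bound (f m)) \<le> (\<Sum>q\<in>Q. cost q)"
      using e(2) by (intro exI[of _ "len q"] exI[of _ f]) simp
  qed
qed

text \<open>The connection starts at the last pair and aims at a translate of the first one. Since
  \<open>fst (K 0) = 0\<close>, the translation by \<open>fst (K p)\<close> puts that translate of
  \<open>K 0\<close> in the cube of \<open>K p\<close>, which is what a bounded connection
  requires.\<close>

lemma close_admissible_sequence:
  obtains C where "\<And>K p. admissible_sequence N Ob K (enat p) \<Longrightarrow> 1 \<le> p \<Longrightarrow>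
    \<exists>P K'. p < P \<and> (\<forall>m\<le>p. K' m = K m) \<and> admissible_sequence N Ob K' \<infinity> \<and>
      (\<forall>m. K' (m + P) = shift (fst (K p)) (K' m)) \<and>
      (\<Sum>m = p..<P. jump_bound (K' m, K' (Suc m))) \<le> C"
proof -
  obtain C where C: "\<And>i j i' j'. vis i j \<Longrightarrow> vis i' j' \<Longrightarrow>
    \<exists>n f. trn (i, j) (f 0) \<and> (\<forall>m<n. trn (f m) (f (Suc m))) \<and>
      trn (f n) (shift2 (fst j - fst i') (i', j')) \<and> (\<Sum>m\<le>n. jump_bound (f m)) \<le> C"
    using bounded_connection by blast
  show ?thesis
  proof (rule that[of C])
    fix K :: "nat \<Rightarrow> (int ^ 'm) \<times> nat" and p
    assume adm: "admissible_sequence N Ob K (enat p)" and p: "1 \<le> p"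
    then have K0: "fst (K 0) = 0" by (simp add: admissible_sequence_def)
    define \<kappa> where "\<kappa> = fst (K p)"
    have Sp: "Suc (p - 1) = p" using p by simp
    have "vis (K (p - 1)) (K p)" "vis (K 0) (K 1)"
      using admissible_visible[OF adm, of "p - 1"] admissible_visible[OF adm, of 0] p by auto
    from C[OF this] K0 obtain n f where f: "trn (K (p - 1), K p) (f 0)"
      "\<And>m. m < n \<Longrightarrow> trn (f m) (f (Suc m))" "trn (f n) (shift2 \<kappa> (K 0, K 1))"
      "(\<Sum>m\<le>n. jump_bound (f m)) \<le> C"
      by (auto simp: \<kappa>_def)
    \<comment> \<open>States are pairs of consecutive terms: those with numbers 0 to
      \<open>p - 1\<close> come from \<open>K\<close>, those from \<open>p\<close> to
      \<open>p + n\<close> from the connection, and number \<open>P\<close> is the translated first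
      pair.\<close>
    define P where "P = p + n + 1"
    define g where "g m = (if m < p then (K m, K (Suc m)) else if m < P then f (m - p)
      else shift2 \<kappa> (K 0, K 1))" for m
    have g_turn: "trn (g m) (g (Suc m))" if m: "m < P" for m
    proof -
      consider "Suc m < p" | "Suc m = p" | "p \<le> m" "m < p + n" | "m = p + n"
        using m unfolding P_def by linarith
      then show ?thesis
      proof cases
        case 1
        then show ?thesis using admissible_turn[OF adm, of m] by (simp add: g_def)
      next
        case 2
        then show ?thesis using f(1) by (auto simp: g_def P_def)
      next
        case 3
        then show ?thesis using f(2)[of "m - p"] by (simp add: g_def P_def Suc_diff_le)
      next
        case 4
        then show ?thesis using f(3) by (simp add: g_def P_def)
      qed
    qed
    have gP: "g P = shift2 \<kappa> (g 0)" using p by (simp add: g_def P_def)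
    obtain G where G: "\<And>m. m \<le> P \<Longrightarrow> G m = g m" "\<And>m. G (m + P) = shift2 \<kappa> (G m)"
      "\<And>m. trn (G m) (G (Suc m))"
      using periodic_turn_walk[OF g_turn gP] by (auto simp: P_def)
    define K' where "K' m = fst (G m)" for m
    have K': "(K' m, K' (Suc m)) = G m" for m
      using G(3)[of m] by (simp add: K'_def turn_def prod_eq_iff)
    have "K' m = K m" if "m \<le> p" for m
      using that G(1)[of m] f(1) by (cases "m = p") (auto simp: K'_def g_def P_def turn_def)
    moreover have "admissible_sequence N Ob K' \<infinity>"
    proof (rule turn_admissible_infinite)
      show "fst (K' 0) = 0" using G(1)[of 0] p K0 by (simp add: K'_def g_def)
      show "trn (K' n, K' (Suc n)) (K' (Suc n), K' (Suc (Suc n)))" for n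
        unfolding K' by (rule G(3))
    qed
    moreover have "K' (m + P) = shift \<kappa> (K' m)" for m
      by (simp add: K'_def G(2))
    moreover have "(\<Sum>m = p..<P. jump_bound (K' m, K' (Suc m))) = (\<Sum>m\<le>n. jump_bound (f m))"
      unfolding K'
      by (rule sum.reindex_bij_witness[of _ "\<lambda>m. m + p" "\<lambda>m. m - p"])
        (auto simp: P_def G(1) g_def)
    moreover have "p < P" by (simp add: P_def)
    ultimately show "\<exists>P K'. p < P \<and> (\<forall>m\<le>p. K' m = K m) \<and> admissible_sequence N Ob K' \<infinity> \<and>
      (\<forall>m. K' (m + P) = shift (fst (K p)) (K' m)) \<and>
      (\<Sum>m = p..<P. jump_bound (K' m, K' (Suc m))) \<le> C"
      using f(4) by (intro exI[of _ P] exI[of _ K']) (simp add: \<kappa>_def)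
  qed
qed

end

section \<open>Trajectories and shortest polygons\<close>

lemma incoming_velocityE:
  assumes "incoming_velocity \<gamma> t v"
  obtains d where "norm v = 1" "d > 0" "\<And>s. t - d < s \<Longrightarrow> s \<le> t \<Longrightarrow> \<gamma> s = \<gamma> t + (s - t) *\<^sub>R v"
proof -
  obtain d where d: "norm v = 1" "d > 0" "\<forall>s\<in>{t - d<..t}. \<gamma> s = \<gamma> t + (s - t) *\<^sub>R v"
    using assms unfolding incoming_velocity_def by blast
  show ?thesis by (rule that[OF d(1,2)], rule bspec[OF d(3)]) simp
qed

lemma outgoing_velocityE:
  assumes "outgoing_velocity \<gamma> t v"
  obtains d where "norm v = 1" "d > 0" "\<And>s. t \<le> s \<Longrightarrow> s < t + d \<Longrightarrow> \<gamma> s = \<gamma> t + (s - t) *\<^sub>R v"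
proof -
  obtain d where d: "norm v = 1" "d > 0" "\<forall>s\<in>{t..<t + d}. \<gamma> s = \<gamma> t + (s - t) *\<^sub>R v"
    using assms unfolding outgoing_velocity_def by blast
  show ?thesis by (rule that[OF d(1,2)], rule bspec[OF d(3)]) simp
qed

lemma incoming_velocity_unique:
  assumes "incoming_velocity \<gamma> t v" "incoming_velocity \<gamma> t w"
  shows "v = w"
proof -
  obtain d where d: "d > 0" "\<And>s. t - d < s \<Longrightarrow> s \<le> t \<Longrightarrow> \<gamma> s = \<gamma> t + (s - t) *\<^sub>R v"
    using assms(1) by (rule incoming_velocityE) blast
  obtain e where e: "e > 0" "\<And>s. t - e < s \<Longrightarrow> s \<le> t \<Longrightarrow> \<gamma> s = \<gamma> t + (s - t) *\<^sub>R w"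
    using assms(2) by (rule incoming_velocityE) blast
  define s where "s = t - min d e / 2"
  have "s < t" "t - d < s" "t - e < s" using d(1) e(1) by (auto simp: s_def min_def)
  with d(2)[of s] e(2)[of s] show ?thesis by simp
qed

lemma outgoing_velocity_unique:
  assumes "outgoing_velocity \<gamma> t v" "outgoing_velocity \<gamma> t w"
  shows "v = w"
proof -
  obtain d where d: "d > 0" "\<And>s. t \<le> s \<Longrightarrow> s < t + d \<Longrightarrow> \<gamma> s = \<gamma> t + (s - t) *\<^sub>R v"
    using assms(1) by (rule outgoing_velocityE) blast
  obtain e where e: "e > 0" "\<And>s. t \<le> s \<Longrightarrow> s < t + e \<Longrightarrow> \<gamma> s = \<gamma> t + (s - t) *\<^sub>R w"
    using assms(2) by (rule outgoing_velocityE) blast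
  define s where "s = t + min d e / 2"
  have "t < s" "s < t + d" "s < t + e" using d(1) e(1) by (auto simp: s_def min_def)
  with d(2)[of s] e(2)[of s] show ?thesis by simp
qed

lemma incoming_velocity_line:
  assumes "norm v = 1" "\<And>t. a \<le> t \<Longrightarrow> t \<le> b \<Longrightarrow> \<gamma> t = x + (t - a) *\<^sub>R v" "a < t" "t \<le> b"
  shows "incoming_velocity \<gamma> t v"
proof -
  have line: "\<gamma> s = \<gamma> t + (s - t) *\<^sub>R v" if "a \<le> s" "s \<le> b" for s
    unfolding assms(2)[OF that] using assms(2)[of t] assms(3,4) by (simp add: algebra_simps)
  show ?thesis
    unfolding incoming_velocity_def
  proof (intro conjI exI[of _ "t - a"] ballI)
    fix s assume "s \<in> {t - (t - a)<..t}"
    with assms(3,4) show "\<gamma> s = \<gamma> t + (s - t) *\<^sub>R v" by (intro line) auto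
  qed (use assms(1,3) in auto)
qed

lemma outgoing_velocity_line:
  assumes "norm v = 1" "\<And>t. a \<le> t \<Longrightarrow> t \<le> b \<Longrightarrow> \<gamma> t = x + (t - a) *\<^sub>R v" "a \<le> t" "t < b"
  shows "outgoing_velocity \<gamma> t v"
proof -
  have line: "\<gamma> s = \<gamma> t + (s - t) *\<^sub>R v" if "a \<le> s" "s \<le> b" for s
    unfolding assms(2)[OF that] using assms(2)[of t] assms(3,4) by (simp add: algebra_simps)
  show ?thesis
    unfolding outgoing_velocity_def
  proof (intro conjI exI[of _ "b - t"] ballI)
    fix s assume "s \<in> {t..<t + (b - t)}"
    with assms(3,4) show "\<gamma> s = \<gamma> t + (s - t) *\<^sub>R v" by (intro line) auto
  qed (use assms(1,4) in auto)
qed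

lemma trajectory_law:
  assumes bt: "billiard_trajectory N Ob L \<gamma>" and "0 < t" "ereal t < L"
    "incoming_velocity \<gamma> t v" "outgoing_velocity \<gamma> t w"
  shows "\<forall>i\<in>obstacle_indices N. \<gamma> t \<in> frontier (obstacle Ob i) \<longrightarrow>
      (\<exists>\<nu>. outward_unit_normal (obstacle Ob i) (\<gamma> t) \<nu> \<and> w = v - (2 * (v \<bullet> \<nu>)) *\<^sub>R \<nu>)"
    and "(\<forall>i\<in>obstacle_indices N. \<gamma> t \<notin> frontier (obstacle Ob i)) \<Longrightarrow> w = v"
  using bt[unfolded billiard_trajectory_def, THEN conjunct2, THEN conjunct2, THEN conjunct2,
      THEN conjunct2, THEN spec, THEN spec, THEN spec, THEN mp, OF conjI[OF assms(2) conjI[OF assms(3)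
        conjI[OF assms(4,5)]]]]
  by (rule conjunct1, elim conjunct2[THEN mp])

text \<open>Continuation argument: let \<open>c\<close> be the supremum of the times up to which the
  initial line is followed. The incoming velocity at \<open>c\<close> places
  \<open>\<gamma> c\<close> on the line; if \<open>c < b\<close>, there is no reflection at
  \<open>c\<close> and the line is followed further.\<close>

lemma trajectory_straight_between_contacts:
  assumes bt: "billiard_trajectory N Ob L \<gamma>" and ab: "0 \<le> a" "a < b" "ereal b \<le> L"
    and free: "\<And>t i. a < t \<Longrightarrow> t < b \<Longrightarrow> i \<in> obstacle_indices N \<Longrightarrow> \<gamma> t \<notin> frontier (obstacle Ob i)"
  obtains v where "norm v = 1" "\<And>t. a \<le> t \<Longrightarrow> t \<le> b \<Longrightarrow> \<gamma> t = \<gamma> a + (t - a) *\<^sub>R v"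
proof -
  have lt: "ereal t < L" if "t < b" for t
    using that ab(3) by (meson ereal_less_le less_ereal.simps(1) order_less_le_trans)
  have le: "ereal t \<le> L" if "t \<le> b" for t
    using that ab(3) by (meson ereal_less_eq(3) order_trans)
  obtain w where w: "outgoing_velocity \<gamma> a w"
    using bt ab lt[of a] unfolding billiard_trajectory_def by blast
  then obtain e where e: "norm w = 1" "e > 0" "\<And>s. a \<le> s \<Longrightarrow> s < a + e \<Longrightarrow> \<gamma> s = \<gamma> a + (s - a) *\<^sub>R w"
    by (rule outgoing_velocityE) blast
  define S where "S = {c\<in>{a..b}. \<forall>t\<in>{a..c}. \<gamma> t = \<gamma> a + (t - a) *\<^sub>R w}"
  define c where "c = Sup S"
  have S_D: "\<gamma> t = \<gamma> a + (t - a) *\<^sub>R w" if "c \<in> S" "t \<in> {a..c}" for c t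
    using that unfolding S_def by blast
  have S_I: "c \<in> S" if "a \<le> c" "c \<le> b" "\<And>t. t \<in> {a..c} \<Longrightarrow> \<gamma> t = \<gamma> a + (t - a) *\<^sub>R w" for c
    unfolding S_def mem_Collect_eq atLeastAtMost_iff[of c] using that by blast
  have bdd: "bdd_above S" by (auto simp: S_def bdd_above_def)
  have "min (a + e / 2) b \<in> S" using ab(2) e(2) by (intro S_I e(3)) auto
  then have "min (a + e / 2) b \<le> c" unfolding c_def by (rule cSup_upper[OF _ bdd])
  with e(2) ab(2) have ac: "a < c" by auto
  have ne: "S \<noteq> {}" using \<open>min (a + e / 2) b \<in> S\<close> by auto
  have cb: "c \<le> b" unfolding c_def by (rule cSup_least[OF ne]) (auto simp: S_def)
  have before: "\<gamma> t = \<gamma> a + (t - a) *\<^sub>R w" if "a \<le> t" "t < c" for t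
  proof -
    obtain c' where "c' \<in> S" "t < c'"
      using \<open>t < c\<close> less_cSup_iff[OF ne bdd] unfolding c_def by blast
    with that show ?thesis by (intro S_D[of c']) auto
  qed
  obtain v where v: "incoming_velocity \<gamma> c v"
    using bt ab(1) ac le[OF cb] unfolding billiard_trajectory_def by (meson le_less_trans)
  then obtain d where d: "d > 0" "\<And>s. c - d < s \<Longrightarrow> s \<le> c \<Longrightarrow> \<gamma> s = \<gamma> c + (s - c) *\<^sub>R v"
    by (rule incoming_velocityE) blast
  \<comment> \<open>Continuity of \<open>\<gamma>\<close> is not among the assumptions. At
    \<open>s1\<close> and \<open>s2\<close> both linear formulas hold; their difference identifies
    the velocities, and then either formula gives \<open>\<gamma> c\<close>.\<close>
  define s1 where "s1 = (max a (c - d) + c) / 2"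
  define s2 where "s2 = (s1 + c) / 2"
  have s: "a < s1" "c - d < s1" "s1 < s2" "s2 < c"
    using ac d(1) by (auto simp: s1_def s2_def max_def field_simps)
  have s1: "\<gamma> a + (s1 - a) *\<^sub>R w = \<gamma> c + (s1 - c) *\<^sub>R v"
    using before[of s1] d(2)[of s1] s by auto
  have s2: "\<gamma> a + (s2 - a) *\<^sub>R w = \<gamma> c + (s2 - c) *\<^sub>R v"
    using before[of s2] d(2)[of s2] s by auto
  have "(s2 - s1) *\<^sub>R w = (\<gamma> a + (s2 - a) *\<^sub>R w) - (\<gamma> a + (s1 - a) *\<^sub>R w)"
    by (simp add: algebra_simps)
  also have "\<dots> = (s2 - s1) *\<^sub>R v" unfolding s1 s2 by (simp add: algebra_simps)
  finally have vw: "v = w" using s by simp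
  have c_eq: "\<gamma> c = \<gamma> a + (c - a) *\<^sub>R w" using s1 unfolding vw by (simp add: algebra_simps)
  have "c = b"
  proof (rule ccontr)
    assume "c \<noteq> b"
    with cb have "c < b" by simp
    obtain w' where w': "outgoing_velocity \<gamma> c w'"
      using bt ab(1) ac lt[OF \<open>c < b\<close>] unfolding billiard_trajectory_def by (meson le_less_trans less_imp_le)
    have "0 < c" using ab(1) ac by simp
    then have "w' = v"
      using trajectory_law(2)[OF bt _ lt[OF \<open>c < b\<close>] v w'] free[OF ac \<open>c < b\<close>] by blast
    then have "outgoing_velocity \<gamma> c w" using w' vw by simp
    then obtain e' where e': "e' > 0" "\<And>s. c \<le> s \<Longrightarrow> s < c + e' \<Longrightarrow> \<gamma> s = \<gamma> c + (s - c) *\<^sub>R w"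
      by (rule outgoing_velocityE) blast
    have after: "\<gamma> s = \<gamma> a + (s - a) *\<^sub>R w" if "a \<le> s" "s < c + e'" for s
      using before[of s] e'(2)[of s] that c_eq by (cases "s < c") (auto simp: algebra_simps)
    have "min (c + e' / 2) b \<in> S" using ac e'(1) \<open>c < b\<close> by (intro S_I after) auto
    then have "min (c + e' / 2) b \<le> c" unfolding c_def by (rule cSup_upper[OF _ bdd])
    with e'(1) \<open>c < b\<close> show False by auto
  qed
  show ?thesis
  proof (rule that[OF e(1)])
    fix t assume t: "a \<le> t" "t \<le> b"
    show "\<gamma> t = \<gamma> a + (t - a) *\<^sub>R w"
    proof (cases "t < c")
      case False
      with t \<open>c = b\<close> have "t = c" by simp
      show ?thesis unfolding \<open>t = c\<close> by (rule c_eq)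
    qed (rule before[OF t(1)])
  qed
qed

lemma billiard_domain_disjoint_interior:
  assumes "x \<in> billiard_domain N Ob" "i \<in> obstacle_indices N"
  shows "x \<notin> interior (obstacle Ob i)"
proof -
  have "interior (obstacle Ob i) \<inter> (UNIV - (\<Union>i\<in>obstacle_indices N. obstacle Ob i)) = {}"
    using assms(2) interior_subset by blast
  then have "interior (obstacle Ob i) \<inter> billiard_domain N Ob = {}"
    unfolding billiard_domain_def by (simp add: open_Int_closure_eq_empty)
  with assms(1) show ?thesis by blast
qed

section \<open>Trajectory pieces as polygons, polygons as trajectories\<close>

context torus_obstacles
begin

lemma obstacle_closed: "i \<in> I \<Longrightarrow> closed (obs i)"
  by (simp add: obstacle_compact compact_imp_closed)

lemma frontier_obstacle_subset: "i \<in> I \<Longrightarrow> frontier (obs i) \<subseteq> obs i"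
  by (simp add: obstacle_closed frontier_subset_closed)

lemma frontier_obstacle_mem: "i \<in> I \<Longrightarrow> x \<in> frontier (obs i) \<Longrightarrow> x \<in> obs i"
  using frontier_obstacle_subset by blast

lemma obstacle_inward:
  assumes "i \<in> I" "x \<in> frontier (obs i)" "outward_unit_normal (obs i) x \<nu>" "0 < v \<bullet> \<nu>"
  obtains e where "e > 0" "\<And>s. 0 < s \<Longrightarrow> s < e \<Longrightarrow> x - s *\<^sub>R v \<in> interior (obs i)"
proof -
  define k where "k = lattice_vec (fst i)"
  have tr: "obs i = (+) k ` B (snd i)" by (simp add: k_def obstacle_translation)
  have r: "snd i \<in> {1..N}" using assms(1) by (simp add: index_range)
  have "x - k \<in> frontier (B (snd i))"
    using assms(2) unfolding tr frontier_translation by auto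
  moreover have "outward_unit_normal (B (snd i)) (x - k) \<nu>"
    using assms(3) unfolding tr outward_unit_normal_def by (auto simp: algebra_simps)
  ultimately obtain e where e: "e > 0" "\<And>s. 0 < s \<Longrightarrow> s < e \<Longrightarrow> (x - k) - s *\<^sub>R v \<in> interior (B (snd i))"
    using C2_boundary_inward[OF base_C2[OF r] compact_imp_closed[OF base_compact[OF r]]] assms(4) by blast
  have "x - s *\<^sub>R v \<in> interior (obs i)" if "0 < s" "s < e" for s
  proof -
    have "k + ((x - k) - s *\<^sub>R v) \<in> (+) k ` interior (B (snd i))" using e(2)[OF that] by (rule imageI)
    then show ?thesis unfolding tr interior_translation by (simp add: algebra_simps)
  qed
  with e(1) show ?thesis by (rule that)
qed

text \<open>By the reflection law \<open>u n - u (Suc n)\<close> is twice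
  \<open>u n \<bullet> \<nu>\<close> times the outward normal \<open>\<nu>\<close>. As
  \<open>u n \<bullet> \<nu> \<le> 0\<close>, its product with \<open>y - x\<close> is nonnegative
  for \<open>y\<close> in the obstacle and \<open>x\<close> the contact point. Only inner contacts
  carry this condition.\<close>

lemma trajectory_piece_segments:
  assumes bt: "billiard_trajectory N Ob (ereal L) \<gamma>" and ty: "has_type N Ob (ereal L) \<gamma> K (enat p)"
  obtains \<tau> u where "\<tau> 0 = 0" "\<tau> p = L"
    "\<And>n. n < p \<Longrightarrow> \<tau> n < \<tau> (Suc n)"
    "\<And>n. n \<le> p \<Longrightarrow> K n \<in> I \<and> \<gamma> (\<tau> n) \<in> obs (K n)"
    "\<And>n. n < p \<Longrightarrow> norm (u n) = 1"
    "\<And>n. n < p \<Longrightarrow> \<gamma> (\<tau> (Suc n)) = \<gamma> (\<tau> n) + (\<tau> (Suc n) - \<tau> n) *\<^sub>R u n"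
    "\<And>n y. Suc n < p \<Longrightarrow> y \<in> obs (K (Suc n)) \<Longrightarrow> 0 \<le> (u n - u (Suc n)) \<bullet> (y - \<gamma> (\<tau> (Suc n)))"
proof -
  from ty obtain \<tau> where sm: "strict_mono_on {n. n \<le> p} \<tau>" and \<tau>0: "\<tau> 0 = 0" and
    contacts: "{t. 0 \<le> t \<and> t \<le> L \<and> (\<exists>i\<in>I. \<gamma> t \<in> frontier (obs i))} = \<tau> ` {n. n \<le> p}" and
    K: "\<And>n. n \<le> p \<Longrightarrow> K n \<in> I" "\<And>n. n \<le> p \<Longrightarrow> \<gamma> (\<tau> n) \<in> frontier (obs (K n))" and \<tau>p: "\<tau> p = L"
    unfolding has_type_def by auto
  have mono: "\<tau> m < \<tau> n" if "m < n" "n \<le> p" for m n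
    using sm that by (auto simp: strict_mono_on_def)
  have mono_le: "\<tau> m \<le> \<tau> n" if "m \<le> n" "n \<le> p" for m n
    using mono[of m n] that by (cases "m = n") auto
  have range: "0 \<le> \<tau> n" "\<tau> n \<le> L" if "n \<le> p" for n
    using mono_le[of 0 n] mono_le[of n p] that \<tau>0 \<tau>p by auto
  have "\<exists>v. norm v = 1 \<and> (\<forall>t. \<tau> n \<le> t \<longrightarrow> t \<le> \<tau> (Suc n) \<longrightarrow> \<gamma> t = \<gamma> (\<tau> n) + (t - \<tau> n) *\<^sub>R v)"
    if n: "n < p" for n
  proof -
    have free: "\<gamma> t \<notin> frontier (obs i)" if t: "\<tau> n < t" "t < \<tau> (Suc n)" "i \<in> I" for t i
    proof
      assume "\<gamma> t \<in> frontier (obs i)"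
      moreover have "0 \<le> t" "t \<le> L" using t range[of n] range[of "Suc n"] n by auto
      ultimately have "t \<in> \<tau> ` {n. n \<le> p}" using contacts t(3) by blast
      then obtain m where m: "m \<le> p" "t = \<tau> m" by auto
      show False
      proof (cases "m \<le> n")
        case True
        then show ?thesis using mono_le[of m n] m n t by auto
      next
        case False
        then show ?thesis using mono_le[of "Suc n" m] m n t by auto
      qed
    qed
    show ?thesis
    proof (rule trajectory_straight_between_contacts[OF bt])
      show "0 \<le> \<tau> n" "\<tau> n < \<tau> (Suc n)" "ereal (\<tau> (Suc n)) \<le> ereal L"
        using n range[of n] range[of "Suc n"] mono[of n "Suc n"] by auto
    qed (use free in blast)+
  qed
  then have "\<forall>n\<in>{..<p}. \<exists>v. norm v = 1 \<and>
      (\<forall>t. \<tau> n \<le> t \<longrightarrow> t \<le> \<tau> (Suc n) \<longrightarrow> \<gamma> t = \<gamma> (\<tau> n) + (t - \<tau> n) *\<^sub>R v)"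
    by blast
  from bchoice[OF this] obtain u where u: "\<And>n. n < p \<Longrightarrow> norm (u n) = 1"
    "\<And>n t. n < p \<Longrightarrow> \<tau> n \<le> t \<Longrightarrow> t \<le> \<tau> (Suc n) \<Longrightarrow> \<gamma> t = \<gamma> (\<tau> n) + (t - \<tau> n) *\<^sub>R u n"
    by blast
  have reflection: "0 \<le> (u n - u (Suc n)) \<bullet> (y - \<gamma> (\<tau> (Suc n)))"
    if n: "Suc n < p" and y: "y \<in> obs (K (Suc n))" for n y
  proof -
    let ?x = "\<gamma> (\<tau> (Suc n))" and ?i = "K (Suc n)"
    have lt: "\<tau> n < \<tau> (Suc n)" "\<tau> (Suc n) < \<tau> (Suc (Suc n))" using mono n by auto
    have "incoming_velocity \<gamma> (\<tau> (Suc n)) (u n)"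
      by (rule incoming_velocity_line[OF u(1) u(2)]) (use n lt in auto)
    moreover have "outgoing_velocity \<gamma> (\<tau> (Suc n)) (u (Suc n))"
      by (rule outgoing_velocity_line[OF u(1) u(2)]) (use n lt in auto)
    moreover have "0 < \<tau> (Suc n)" "\<tau> (Suc n) < L"
      using mono[of 0 "Suc n"] mono[of "Suc n" p] n \<tau>0 \<tau>p by auto
    moreover have "?i \<in> I" "?x \<in> frontier (obs ?i)" using K n by auto
    ultimately obtain \<nu> where \<nu>: "outward_unit_normal (obs ?i) ?x \<nu>"
      "u (Suc n) = u n - (2 * (u n \<bullet> \<nu>)) *\<^sub>R \<nu>"
      using trajectory_law(1)[OF bt, of "\<tau> (Suc n)" "u n" "u (Suc n)"] by auto
    \<comment> \<open>Otherwise the points shortly before the contact would be interior to the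
      obstacle, but the billiard domain contains no such points.\<close>
    have "u n \<bullet> \<nu> \<le> 0"
    proof (rule ccontr)
      assume "\<not> u n \<bullet> \<nu> \<le> 0"
      then obtain e where e: "e > 0" "\<And>s. 0 < s \<Longrightarrow> s < e \<Longrightarrow> ?x - s *\<^sub>R u n \<in> interior (obs ?i)"
        using obstacle_inward[OF \<open>?i \<in> I\<close> \<open>?x \<in> frontier (obs ?i)\<close> \<nu>(1), of "u n"] by auto
      define s where "s = min (e / 2) (\<tau> (Suc n) - \<tau> n)"
      have s: "0 < s" "s < e" "s \<le> \<tau> (Suc n) - \<tau> n" using e(1) lt by (auto simp: s_def)
      have "\<gamma> (\<tau> (Suc n) - s) = ?x - s *\<^sub>R u n"
      proof -
        have 1: "\<gamma> (\<tau> (Suc n) - s) = \<gamma> (\<tau> n) + (\<tau> (Suc n) - s - \<tau> n) *\<^sub>R u n"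
          by (rule u(2)) (use s n in auto)
        have 2: "?x = \<gamma> (\<tau> n) + (\<tau> (Suc n) - \<tau> n) *\<^sub>R u n"
          by (rule u(2)) (use lt n in auto)
        show ?thesis unfolding 1 2 by (simp add: algebra_simps)
      qed
      moreover have "\<gamma> (\<tau> (Suc n) - s) \<in> billiard_domain N Ob"
        using bt s range[of n] range[of "Suc n"] n unfolding billiard_trajectory_def by auto
      ultimately show False
        using billiard_domain_disjoint_interior[OF _ \<open>?i \<in> I\<close>] e(2)[OF s(1,2)] by auto
    qed
    moreover have "\<nu> \<bullet> (y - ?x) \<le> 0" using \<nu>(1) y by (simp add: outward_unit_normal_def)
    ultimately show ?thesis by (simp add: \<nu>(2) mult_nonpos_nonpos)
  qed
  show ?thesis
  proof (rule that[OF \<tau>0 \<tau>p _ _ u(1) u(2) reflection])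
    show "K n \<in> I \<and> \<gamma> (\<tau> n) \<in> obs (K n)" if "n \<le> p" for n
      using K[OF that] frontier_obstacle_subset by blast
  qed (simp_all add: mono less_imp_le)
qed

lemma trajectory_piece_length_minimal:
  assumes "billiard_trajectory N Ob (ereal L) \<gamma>" "has_type N Ob (ereal L) \<gamma> K (enat p)"
    and y: "\<And>n. n \<le> p \<Longrightarrow> y n \<in> obs (K n)"
  shows "L \<le> (\<Sum>n<p. norm (y (Suc n) - y n)) + norm (y 0 - \<gamma> 0) + norm (y p - \<gamma> L)"
proof -
  from assms(1,2) obtain \<tau> u where t: "\<tau> 0 = 0" "\<tau> p = L"
    "\<And>n. n < p \<Longrightarrow> norm (u n) = 1"
    "\<And>n. n < p \<Longrightarrow> \<gamma> (\<tau> (Suc n)) = \<gamma> (\<tau> n) + (\<tau> (Suc n) - \<tau> n) *\<^sub>R u n"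
    "\<And>n y. Suc n < p \<Longrightarrow> y \<in> obs (K (Suc n)) \<Longrightarrow> 0 \<le> (u n - u (Suc n)) \<bullet> (y - \<gamma> (\<tau> (Suc n)))"
    by (rule trajectory_piece_segments) blast
  have "L = (\<Sum>n<p. \<tau> (Suc n) - \<tau> n)"
    using t(1,2) by (simp add: sum_lessThan_telescope)
  also have "\<dots> \<le> (\<Sum>n<p. norm (y (Suc n) - y n)) + norm (y 0 - \<gamma> (\<tau> 0)) + norm (y p - \<gamma> (\<tau> p))"
    by (rule polygon_length_lower_bound[where u = u]) (use t y in auto)
  finally show ?thesis by (simp add: t(1,2))
qed

text \<open>The polygon is traversed by arc length, vertex \<open>n\<close> at time
  \<open>\<tau> n\<close>. The hypothesis \<open>unbounded\<close> keeps vertices from accumulating,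
  so that all times are covered; by \<open>free\<close> the vertices are the only contacts.\<close>

lemma polygon_trajectory:
  fixes x :: "nat \<Rightarrow> real ^ 'm"
  defines "u \<equiv> \<lambda>n. sgn (x (Suc n) - x n)" and "\<tau> \<equiv> \<lambda>n. \<Sum>k<n. norm (x (Suc k) - x k)"
  assumes K: "\<And>n. K n \<in> I" "\<And>n. x n \<in> frontier (obs (K n))"
    and ne: "\<And>n. x (Suc n) \<noteq> x n"
    and free: "\<And>n i. i \<in> I \<Longrightarrow> open_segment (x n) (x (Suc n)) \<inter> obs i = {}"
    and refl: "\<And>n. \<exists>\<nu>. outward_unit_normal (obs (K (Suc n))) (x (Suc n)) \<nu> \<and>
      u (Suc n) = u n - (2 * (u n \<bullet> \<nu>)) *\<^sub>R \<nu>"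
    and unbounded: "\<And>t. \<exists>n. t < \<tau> n"
  obtains \<gamma> where "billiard_trajectory N Ob \<infinity> \<gamma>" "has_type N Ob \<infinity> \<gamma> K \<infinity>"
    "\<And>t. 0 \<le> t \<Longrightarrow> \<exists>n. \<tau> n \<le> t \<and> t < \<tau> (Suc n)"
    "\<And>n t. \<tau> n \<le> t \<Longrightarrow> t \<le> \<tau> (Suc n) \<Longrightarrow> \<gamma> t = x n + (t - \<tau> n) *\<^sub>R u n"
proof -
  have step: "\<tau> (Suc n) = \<tau> n + norm (x (Suc n) - x n)" for n by (simp add: \<tau>_def)
  have \<tau>0: "\<tau> 0 = 0" by (simp add: \<tau>_def)
  have lt: "\<tau> n < \<tau> (Suc n)" for n using ne by (simp add: step)
  then have sm: "strict_mono \<tau>" by (simp add: strict_mono_Suc_iff)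
  have norm_u: "norm (u n) = 1" for n using ne by (simp add: u_def norm_sgn)
  have nonneg: "0 \<le> \<tau> n" for n unfolding \<tau>_def by (simp add: sum_nonneg)
  have locate: "\<exists>n. \<tau> n \<le> t \<and> t < \<tau> (Suc n)" if "0 \<le> t" for t
  proof -
    obtain n where n: "t < \<tau> n" using unbounded by blast
    define m where "m = (LEAST n. t < \<tau> n)"
    have m: "t < \<tau> m" unfolding m_def using n by (rule LeastI)
    with \<tau>0 that obtain k where k: "m = Suc k" by (cases m) auto
    then have "\<not> t < \<tau> k" unfolding m_def by (intro not_less_Least) auto
    with m k show ?thesis by (intro exI[of _ k]) simp
  qed
  \<comment> \<open>The half-open intervals from \<open>\<tau> n\<close> to
    \<open>\<tau> (Suc n)\<close> make the chosen \<open>n\<close> unique; agreement at the right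
    end is shown in \<open>\<gamma>_eq\<close>.\<close>
  define \<gamma> where "\<gamma> t = (let n = SOME n. \<tau> n \<le> t \<and> t < \<tau> (Suc n) in x n + (t - \<tau> n) *\<^sub>R u n)" for t
  have unique: "m = n" if "\<tau> m \<le> t" "t < \<tau> (Suc m)" "\<tau> n \<le> t" "t < \<tau> (Suc n)" for m n t
  proof -
    have "\<tau> m < \<tau> (Suc n)" "\<tau> n < \<tau> (Suc m)" using that by linarith+
    then have "m < Suc n" "n < Suc m" using strict_mono_less[OF sm] by blast+
    then show ?thesis by simp
  qed
  have \<gamma>_less: "\<gamma> t = x n + (t - \<tau> n) *\<^sub>R u n" if "\<tau> n \<le> t" "t < \<tau> (Suc n)" for n t
  proof -
    have "(SOME n. \<tau> n \<le> t \<and> t < \<tau> (Suc n)) = n" using that unique by (intro some_equality) auto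
    then show ?thesis by (simp add: \<gamma>_def)
  qed
  have \<gamma>_vertex: "\<gamma> (\<tau> n) = x n" for n using \<gamma>_less[of n "\<tau> n"] lt by simp
  have \<gamma>_eq: "\<gamma> t = x n + (t - \<tau> n) *\<^sub>R u n" if "\<tau> n \<le> t" "t \<le> \<tau> (Suc n)" for n t
  proof (cases "t = \<tau> (Suc n)")
    case True
    have "(\<tau> (Suc n) - \<tau> n) *\<^sub>R u n = x (Suc n) - x n"
      using ne by (simp add: step u_def sgn_div_norm)
    with True show ?thesis by (simp add: \<gamma>_vertex)
  qed (use \<gamma>_less that in auto)
  have \<gamma>_seg: "\<gamma> t \<in> open_segment (x n) (x (Suc n))" if "\<tau> n < t" "t < \<tau> (Suc n)" for n t
  proof -
    define s where "s = (t - \<tau> n) / norm (x (Suc n) - x n)"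
    have "0 < s" "s < 1" using that ne by (auto simp: s_def step)
    moreover have "\<gamma> t = (1 - s) *\<^sub>R x n + s *\<^sub>R x (Suc n)"
    proof -
      have "(t - \<tau> n) *\<^sub>R u n = s *\<^sub>R (x (Suc n) - x n)"
        by (simp add: u_def sgn_div_norm s_def divide_inverse)
      moreover have "\<gamma> t = x n + (t - \<tau> n) *\<^sub>R u n" using \<gamma>_eq[of n t] that by simp
      ultimately have "\<gamma> t = x n + s *\<^sub>R (x (Suc n) - x n)" by metis
      then show ?thesis by (simp add: algebra_simps)
    qed
    ultimately show ?thesis using ne[of n] by (auto simp: in_segment)
  qed
  have frontier_notin: "\<gamma> t \<notin> frontier (obs i)" if "\<tau> n < t" "t < \<tau> (Suc n)" "i \<in> I" for n t i
    using \<gamma>_seg[OF that(1,2)] free[OF that(3)] frontier_obstacle_subset[OF that(3)] by blast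
  have domain: "\<gamma> t \<in> billiard_domain N Ob" if "0 \<le> t" for t
  proof -
    from locate[OF that] obtain n where n: "\<tau> n \<le> t" "t < \<tau> (Suc n)" by blast
    \<comment> \<open>Vertices lie on obstacles, hence not in the complement itself; they are
      reached as limits, the domain being the closure of the complement.\<close>
    have "open_segment (x n) (x (Suc n)) \<subseteq> UNIV - (\<Union>i\<in>I. obs i)" using free by blast
    then have "closed_segment (x n) (x (Suc n)) \<subseteq> billiard_domain N Ob"
      unfolding billiard_domain_def using closure_mono ne[of n] by (metis closure_open_segment)
    moreover have "\<gamma> t \<in> closed_segment (x n) (x (Suc n))"
      using n \<gamma>_seg[of n t] \<gamma>_vertex[of n] by (cases "t = \<tau> n") (auto simp: open_segment_def)
    ultimately show ?thesis by blast
  qed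
  have incoming: "incoming_velocity \<gamma> t (u n)" if "\<tau> n < t" "t \<le> \<tau> (Suc n)" for n t
    by (rule incoming_velocity_line[OF norm_u \<gamma>_eq]) (use that in auto)
  have outgoing: "outgoing_velocity \<gamma> t (u n)" if "\<tau> n \<le> t" "t < \<tau> (Suc n)" for n t
    by (rule outgoing_velocity_line[OF norm_u \<gamma>_eq]) (use that in auto)
  have locate': "\<exists>n. \<tau> n < t \<and> t \<le> \<tau> (Suc n)" if t: "0 < t" for t
  proof -
    from t have "0 \<le> t" by simp
    from locate[OF this] obtain n where n: "\<tau> n \<le> t" "t < \<tau> (Suc n)" by blast
    show ?thesis
    proof (cases "\<tau> n = t")
      case True
      then obtain k where "n = Suc k" using t \<tau>0 by (cases n) auto
      with True lt[of k] show ?thesis by auto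
    next
      case False
      with n show ?thesis by (intro exI[of _ n]) simp
    qed
  qed
  have law: "(\<forall>i\<in>I. \<gamma> t \<in> frontier (obs i) \<longrightarrow>
           (\<exists>\<nu>. outward_unit_normal (obs i) (\<gamma> t) \<nu> \<and> w = v - (2 * (v \<bullet> \<nu>)) *\<^sub>R \<nu>)) \<and>
        ((\<forall>i\<in>I. \<gamma> t \<notin> frontier (obs i)) \<longrightarrow> w = v)"
    if t: "0 < t" and v: "incoming_velocity \<gamma> t v" and w: "outgoing_velocity \<gamma> t w" for t v w
  proof -
    from locate'[OF t] obtain n where n: "\<tau> n < t" "t \<le> \<tau> (Suc n)" by blast
    have v: "v = u n" using incoming_velocity_unique[OF v incoming[OF n]] .
    show ?thesis
    proof (cases "t = \<tau> (Suc n)")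
      case True
      have w: "w = u (Suc n)" using outgoing_velocity_unique[OF w outgoing[of "Suc n" t]] True lt by simp
      \<comment> \<open>Obstacles are disjoint, so at a vertex the law concerns one obstacle
        alone.\<close>
      have only: "i = K (Suc n)" if "i \<in> I" "\<gamma> t \<in> frontier (obs i)" for i
        using that K[of "Suc n"] frontier_obstacle_mem True \<gamma>_vertex
          obstacle_unique[of i "K (Suc n)" "x (Suc n)"] by simp
      have x: "\<gamma> t = x (Suc n)" using True \<gamma>_vertex by simp
      obtain \<nu> where \<nu>: "outward_unit_normal (obs (K (Suc n))) (x (Suc n)) \<nu>"
        "u (Suc n) = u n - (2 * (u n \<bullet> \<nu>)) *\<^sub>R \<nu>" using refl[of n] by blast
      show ?thesis
      proof (intro conjI ballI impI)
        fix i assume "i \<in> I" "\<gamma> t \<in> frontier (obs i)"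
        then have "i = K (Suc n)" by (rule only)
        with \<nu> show "\<exists>\<nu>. outward_unit_normal (obs i) (\<gamma> t) \<nu> \<and> w = v - (2 * (v \<bullet> \<nu>)) *\<^sub>R \<nu>"
          unfolding x v w by blast
      next
        assume "\<forall>i\<in>I. \<gamma> t \<notin> frontier (obs i)"
        with K[of "Suc n"] x show "w = v" by simp
      qed
    next
      case False
      then have "t < \<tau> (Suc n)" using n by simp
      moreover from this have "w = u n" using outgoing_velocity_unique[OF w outgoing[of n t]] n by simp
      ultimately show ?thesis using frontier_notin[OF n(1)] v by auto
    qed
  qed
  show ?thesis
  proof (rule that[of \<gamma>])
    show "billiard_trajectory N Ob \<infinity> \<gamma>"
    proof -
      have "\<forall>t. 0 \<le> t \<and> ereal t \<le> \<infinity> \<longrightarrow> \<gamma> t \<in> billiard_domain N Ob"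
        using domain by blast
      moreover have "\<forall>t. 0 < t \<and> ereal t \<le> \<infinity> \<longrightarrow> (\<exists>v. incoming_velocity \<gamma> t v)"
        using locate' incoming by blast
      moreover have "\<forall>t. 0 \<le> t \<and> ereal t < \<infinity> \<longrightarrow> (\<exists>w. outgoing_velocity \<gamma> t w)"
        using locate outgoing by blast
      ultimately show ?thesis
        unfolding billiard_trajectory_def using law by (intro conjI) (simp, assumption+, blast)
    qed
    have "{t. 0 \<le> t \<and> (\<exists>i\<in>I. \<gamma> t \<in> frontier (obs i))} = range \<tau>"
    proof (intro set_eqI iffI)
      fix t assume t: "t \<in> {t. 0 \<le> t \<and> (\<exists>i\<in>I. \<gamma> t \<in> frontier (obs i))}"
      then have "0 \<le> t" by simp
      from locate[OF this] obtain n where n: "\<tau> n \<le> t" "t < \<tau> (Suc n)" by blast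
      with t frontier_notin[of n t] have "t = \<tau> n" by force
      then show "t \<in> range \<tau>" by simp
    next
      fix t assume "t \<in> range \<tau>"
      then obtain n where "t = \<tau> n" by blast
      with nonneg[of n] K[of n] \<gamma>_vertex[of n] show "t \<in> {t. 0 \<le> t \<and> (\<exists>i\<in>I. \<gamma> t \<in> frontier (obs i))}"
        by auto
    qed
    then show "has_type N Ob \<infinity> \<gamma> K \<infinity>"
      unfolding has_type_def using sm \<tau>0 K \<gamma>_vertex
      by (intro exI[of _ \<tau>]) (auto simp: strict_mono_def)
  qed (fact locate, fact \<gamma>_eq)
qed

end

text \<open>Distinct unit vectors are mirror images in the hyperplane orthogonal to their
  difference. From \<open>norm (w - u)\<close> squared being \<open>2 - 2 * (u \<bullet> w)\<close>,
  the products of \<open>u\<close> and \<open>w\<close> with \<open>\<nu>\<close> are minus and plus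
  half of \<open>norm (w - u)\<close>.\<close>

lemma reflection_unit_vectors:
  fixes u w :: "'a::real_inner"
  assumes "norm u = 1" "norm w = 1" "u \<noteq> w"
  defines "\<nu> \<equiv> sgn (w - u)"
  shows "norm \<nu> = 1" "w = u - (2 * (u \<bullet> \<nu>)) *\<^sub>R \<nu>" "u \<bullet> \<nu> < 0" "0 < w \<bullet> \<nu>"
proof -
  let ?r = "norm (w - u)"
  have r: "0 < ?r" using assms(3) by simp
  have uw: "u \<bullet> u = 1" "w \<bullet> w = 1" using assms(1,2) by (simp_all add: dot_square_norm)
  have r2: "?r * ?r = 2 - 2 * (u \<bullet> w)"
    using dot_square_norm[of "w - u"] uw
    by (simp add: power2_eq_square inner_diff_left inner_diff_right inner_commute)
  have \<nu>: "\<nu> = (1 / ?r) *\<^sub>R (w - u)" by (simp add: \<nu>_def sgn_div_norm divide_inverse)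
  show "norm \<nu> = 1" using assms(3) by (simp add: \<nu>_def norm_sgn)
  have uw': "u \<bullet> w = 1 - ?r * ?r / 2" using r2 by linarith
  have u: "u \<bullet> \<nu> = - ?r / 2"
    using r by (simp add: \<nu> inner_diff_right uw uw')
  have w: "w \<bullet> \<nu> = ?r / 2"
    using r by (simp add: \<nu> inner_diff_right uw uw' inner_commute[of w u])
  show "u \<bullet> \<nu> < 0" "0 < w \<bullet> \<nu>" using u w r by linarith+
  have "(2 * (u \<bullet> \<nu>)) *\<^sub>R \<nu> = u - w" using r by (simp add: u) (simp add: \<nu> scaleR_diff_right)
  then show "w = u - (2 * (u \<bullet> \<nu>)) *\<^sub>R \<nu>" by simp
qed

text \<open>This puts the vertices of a minimizer over filled obstacles on the boundaries: from an
  interior point one could move along \<open>\<nu>\<close> inside \<open>K\<close>.\<close>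

lemma outward_unit_normal_frontier:
  assumes "outward_unit_normal K x \<nu>" "x \<in> K"
  shows "x \<in> frontier K"
proof -
  have "x \<notin> interior K"
  proof
    assume "x \<in> interior K"
    then obtain e where e: "e > 0" "ball x e \<subseteq> K" by (auto simp: mem_interior)
    have \<nu>: "norm \<nu> = 1" "\<And>y. y \<in> K \<Longrightarrow> \<nu> \<bullet> (y - x) \<le> 0"
      using assms(1) by (auto simp: outward_unit_normal_def)
    have "x + (e / 2) *\<^sub>R \<nu> \<in> K" using e \<nu>(1) by (intro subsetD[OF e(2)]) (simp add: dist_norm)
    from \<nu>(2)[OF this] have "e / 2 * (\<nu> \<bullet> \<nu>) \<le> 0" by simp
    with e(1) \<nu>(1) show False by (simp add: dot_square_norm)
  qed
  with assms(2) closure_subset show ?thesis by (auto simp: frontier_def)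
qed

section \<open>Shortest closed polygons are periodic orbits\<close>

context torus_obstacles
begin

lemma periodic_shift:
  assumes "\<And>m. K (m + P) = shift k (K m)"
  shows "K (m + q * P) = shift (int q *s k) (K m)"
proof (induction q)
  case (Suc q)
  have "int (Suc q) *s k = int q *s k + k" by (simp add: vec_eq_iff algebra_simps)
  with Suc assms[of "m + q * P"] show ?case by (simp add: algebra_simps)
qed simp

lemma wrap_mem:
  assumes "\<And>m. K (m + P) = shift k (K m)" "0 < P" "\<And>m. m < P \<Longrightarrow> z m \<in> obs (K m)"
  shows "wrap P (lattice_vec k) z n \<in> obs (K n)"
proof -
  have "K n = shift (int (n div P) *s k) (K (n mod P))"
    using periodic_shift[of K P k "n mod P" "n div P", OF assms(1)] by (simp only: mod_div_mult_eq)
  with assms(3)[of "n mod P"] assms(2) show ?thesis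
    by (simp add: wrap_def mem_obstacle_shift_iff flip: lattice_vec_smult)
qed

lemma shortest_periodic_polygon:
  assumes per: "\<And>m. K (m + P) = shift k (K m)" and P: "0 < P" and K: "\<And>m. K m \<in> I"
  obtains x where "\<And>m. x m \<in> obs (K m)" "\<And>m. x (m + P) = x m + lattice_vec k"
    "\<And>y. (\<And>m. y m \<in> obs (K m)) \<Longrightarrow> (\<And>m. y (m + P) = y m + lattice_vec k) \<Longrightarrow>
       (\<Sum>n<P. norm (x (Suc n) - x n)) \<le> (\<Sum>n<P. norm (y (Suc n) - y n))"
proof -
  obtain z where z: "\<And>n. z n \<in> obs (K n)" "\<And>y. (\<And>n. y n \<in> obs (K n)) \<Longrightarrow>
       (\<Sum>n<P. norm (wrap P (lattice_vec k) z (Suc n) - wrap P (lattice_vec k) z n))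
       \<le> (\<Sum>n<P. norm (wrap P (lattice_vec k) y (Suc n) - wrap P (lattice_vec k) y n))"
    by (rule closed_polygon_minimizer[of "\<lambda>n. obs (K n)" P "lattice_vec k"])
      (use K obstacle_compact obstacle_nonempty in blast)+
  show ?thesis
  proof (rule that[of "wrap P (lattice_vec k) z"])
    show "wrap P (lattice_vec k) z m \<in> obs (K m)" for m
      by (rule wrap_mem[of K P k z, OF per P z(1)])
    show "wrap P (lattice_vec k) z (m + P) = wrap P (lattice_vec k) z m + lattice_vec k" for m
      by (rule wrap_add_period[OF P])
    fix y assume y: "\<And>m. y m \<in> obs (K m)" "\<And>m. y (m + P) = y m + lattice_vec k"
    from z(2)[OF y(1)] show "(\<Sum>n<P. norm (wrap P (lattice_vec k) z (Suc n) - wrap P (lattice_vec k) z n))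
       \<le> (\<Sum>n<P. norm (y (Suc n) - y n))"
      unfolding wrap_periodic[of y P, OF y(2)] .
  qed
qed

text \<open>One vertex is varied together with all its translates. Since \<open>P \<ge> 2\<close>,
  its two neighbours belong to other classes modulo \<open>P\<close> and stay fixed, so that only
  two edges per period change.\<close>

lemma shortest_periodic_polygon_local:
  assumes per: "\<And>m. K (m + P) = shift k (K m)" and P: "2 \<le> P"
    and x: "\<And>m. x m \<in> obs (K m)" "\<And>m. x (m + P) = x m + lattice_vec k"
    and min: "\<And>y. (\<And>m. y m \<in> obs (K m)) \<Longrightarrow> (\<And>m. y (m + P) = y m + lattice_vec k) \<Longrightarrow>
       (\<Sum>n<P. norm (x (Suc n) - x n)) \<le> (\<Sum>n<P. norm (y (Suc n) - y n))"
    and w: "w \<in> obs (K (Suc n))"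
  shows "norm (x (Suc n) - x n) + norm (x (Suc (Suc n)) - x (Suc n))
    \<le> norm (w - x n) + norm (x (Suc (Suc n)) - w)"
proof -
  define y where "y m = (if m mod P = Suc n mod P then x m + (w - x (Suc n)) else x m)" for m
  have x_per: "x (m + q * P) = x m + lattice_vec (int q *s k)" for m q
    unfolding lattice_vec_smult by (rule quasi_periodic_mult) (rule x(2))
  have y_mem: "y m \<in> obs (K m)" for m
  proof (cases "m mod P = Suc n mod P")
    case True
    show ?thesis
    proof (cases "Suc n \<le> m")
      case le: True
      obtain q where q: "m = Suc n + q * P"
        using mod_eq_nat1E[OF True le] by (metis mult.commute)
      have "w + lattice_vec (int q *s k) \<in> obs (shift (int q *s k) (K (Suc n)))"
        using w by (simp only: mem_obstacle_shift_iff)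
      then show ?thesis
        using True unfolding y_def q periodic_shift[of K P k, OF per] x_per by (simp add: algebra_simps)
    next
      case False
      then obtain q where q: "Suc n = m + q * P"
        using mod_eq_nat1E[of "Suc n" P m] True by (metis mult.commute nat_le_linear)
      have "(w - lattice_vec (int q *s k)) + lattice_vec (int q *s k) \<in> obs (shift (int q *s k) (K m))"
        using w unfolding q periodic_shift[of K P k, OF per] by simp
      then have "w - lattice_vec (int q *s k) \<in> obs (K m)"
        by (simp only: mem_obstacle_shift_iff)
      then show ?thesis
        using True x_per[of m q] unfolding y_def q by (simp add: algebra_simps)
    qed
  qed (simp add: y_def x(1))
  have y_per: "y (m + P) = y m + lattice_vec k" for m
    by (simp add: y_def x(2))
  have other: "y (Suc n + i) = x (Suc n + i)" if "0 < i" "i < P" for i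
  proof -
    have "(Suc n + i) mod P \<noteq> Suc n mod P"
    proof
      assume "(Suc n + i) mod P = Suc n mod P"
      then have "P dvd (Suc n + i) - Suc n" by (intro mod_eq_dvd_iff_nat[THEN iffD1]) auto
      with that show False by (auto dest: dvd_imp_le)
    qed
    then show ?thesis by (simp add: y_def)
  qed
  obtain P' where P': "P = Suc (Suc P')" using P le_Suc_ex[of 2 P] by auto
  \<comment> \<open>Modulo \<open>P\<close>, the predecessor \<open>n\<close> is the index
    \<open>Suc n + (P - 1)\<close>, to which \<open>other\<close> applies.\<close>
  have yn: "y n = x n"
  proof -
    have "y (n + P) = x (n + P)" using other[of "Suc P'"] P' by simp
    then show ?thesis by (simp add: y_per x(2))
  qed
  have ySn: "y (Suc n) = w" by (simp add: y_def)
  define h where "h z m = norm (z (Suc m) - z m)" for z :: "nat \<Rightarrow> real ^ 'm" and m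
  have h_per: "h z (m + P) = h z m" if "\<And>m. z (m + P) = z m + lattice_vec k" for z m
    using that[of m] that[of "Suc m"] by (simp add: h_def)
  \<comment> \<open>The period window is moved to begin at \<open>n\<close>, so that the two edges
    at the varied vertex come first.\<close>
  have split: "(\<Sum>m<P. h z m) = h z n + h z (Suc n) + (\<Sum>j<P'. h z (Suc (Suc n) + j))"
    if "\<And>m. z (m + P) = z m + lattice_vec k" for z
  proof -
    have "(\<Sum>m<P. h z m) = (\<Sum>j<P. h z (n + j))"
      using sum_shift_period[of "h z" P n, OF h_per[of z, OF that]] by simp
    then show ?thesis
      unfolding P' by (simp add: sum.lessThan_Suc_shift del: sum.lessThan_Suc)
  qed
  have "(\<Sum>j<P'. h y (Suc (Suc n) + j)) = (\<Sum>j<P'. h x (Suc (Suc n) + j))"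
  proof (rule sum.cong[OF HOL.refl])
    fix j assume "j \<in> {..<P'}"
    then show "h y (Suc (Suc n) + j) = h x (Suc (Suc n) + j)"
      using other[of "Suc j"] other[of "Suc (Suc j)"] P' by (simp add: h_def)
  qed
  moreover have "(\<Sum>m<P. h x m) \<le> (\<Sum>m<P. h y m)"
    unfolding h_def by (rule min[OF y_mem y_per])
  ultimately have "h x n + h x (Suc n) \<le> h y n + h y (Suc n)"
    by (simp add: split[of x, OF x(2)] split[of y, OF y_per])
  moreover have "y (Suc (Suc n)) = x (Suc (Suc n))" using other[of 1] P by simp
  ultimately show ?thesis by (simp add: h_def yn ySn)
qed

text \<open>The two non-betweenness conditions turn the minimizer into a billiard path: (iv) makes
  it turn at every vertex, so that normals exist, and (iii) clears its edges of further
  obstacles.\<close>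

lemma admissible_periodic_orbit_exists:
  assumes adm: "admissible_sequence N Ob K \<infinity>" and per: "\<And>m. K (m + P) = shift k (K m)" and P: "2 \<le> P"
  obtains T \<gamma> x where "admissible_periodic_orbit N Ob T \<gamma>" "displacement T \<gamma> = lattice_vec k"
    "T = (\<Sum>n<P. norm (x (Suc n) - x n))" "\<And>m. x m \<in> obs (K m)"
    "\<And>y. (\<And>m. y m \<in> obs (K m)) \<Longrightarrow> (\<And>m. y (m + P) = y m + lattice_vec k) \<Longrightarrow>
       T \<le> (\<Sum>n<P. norm (y (Suc n) - y n))"
proof -
  have vis: "vis (K n) (K (Suc n))" for n using admissible_visible[OF adm] by simp
  have trn: "trn (K n, K (Suc n)) (K (Suc n), K (Suc (Suc n)))" for n
    using admissible_turn[OF adm] by simp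
  have K: "K n \<in> I" for n using vis[of n] by (simp add: visible_def)
  have P0: "0 < P" using P by simp
  obtain x where x: "\<And>m. x m \<in> obs (K m)" "\<And>m. x (m + P) = x m + lattice_vec k"
    and min: "\<And>y. (\<And>m. y m \<in> obs (K m)) \<Longrightarrow> (\<And>m. y (m + P) = y m + lattice_vec k) \<Longrightarrow>
       (\<Sum>n<P. norm (x (Suc n) - x n)) \<le> (\<Sum>n<P. norm (y (Suc n) - y n))"
    using shortest_periodic_polygon[of K P k, OF per P0 K] by blast
  define u where "u n = sgn (x (Suc n) - x n)" for n
  define \<tau> where "\<tau> n = (\<Sum>k<n. norm (x (Suc k) - x k))" for n
  have ne: "x (Suc n) \<noteq> x n" for n
    using obstacle_unique[OF K K x(1), of n "Suc n"] x(1)[of "Suc n"] vis[of n]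
    by (metis visible_def)
  have norm_u: "norm (u n) = 1" for n using ne by (simp add: u_def norm_sgn)
  have step: "x (Suc n) = x n + norm (x (Suc n) - x n) *\<^sub>R u n" for n
    using ne by (simp add: u_def sgn_div_norm)
  have first_order: "0 \<le> (u n - u (Suc n)) \<bullet> (y - x (Suc n))" if "y \<in> obs (K (Suc n))" for n y
    unfolding u_def
    by (rule norm_sum_minimizer_first_order[OF obstacle_convex[OF K] x(1) ne ne[symmetric] that])
      (rule shortest_periodic_polygon_local[OF per P x min])
  \<comment> \<open>Without a turn the vertex would lie on the segment joining its neighbours, so
    its obstacle would be between theirs.\<close>
  have turns: "u n \<noteq> u (Suc n)" for n
  proof
    assume eq: "u n = u (Suc n)"
    define a where "a = norm (x (Suc n) - x n)"
    define b where "b = norm (x (Suc (Suc n)) - x (Suc n))"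
    have ab: "0 < a" "0 < b" using ne by (simp_all add: a_def b_def)
    have x1: "x (Suc n) = x n + a *\<^sub>R u n" unfolding a_def by (rule step)
    have x2: "x (Suc (Suc n)) = x (Suc n) + b *\<^sub>R u n" unfolding b_def eq by (rule step)
    have "x (Suc n) = (1 - a / (a + b)) *\<^sub>R x n + (a / (a + b)) *\<^sub>R x (Suc (Suc n))"
      using ab unfolding x2 x1 by (simp add: algebra_simps flip: scaleR_add_left) (simp add: field_simps)
    moreover have "x n \<in> convex hull (obs (K n) \<union> obs (K (Suc (Suc n))))"
      "x (Suc (Suc n)) \<in> convex hull (obs (K n) \<union> obs (K (Suc (Suc n))))"
      using x(1) by (auto intro: hull_inc)
    moreover have "0 \<le> 1 - a / (a + b)" "0 \<le> a / (a + b)" using ab by (simp_all add: field_simps)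
    ultimately have "x (Suc n) \<in> convex hull (obs (K n) \<union> obs (K (Suc (Suc n))))"
      using convexD[OF convex_convex_hull, of "x n" _ "x (Suc (Suc n))" "1 - a / (a + b)" "a / (a + b)"]
      by simp
    with x(1)[of "Suc n"] trn[of n] show False
      by (auto simp: turn_def obstacle_between_def visible_def)
  qed
  define \<nu> where "\<nu> n = sgn (u (Suc n) - u n)" for n
  note \<nu> = reflection_unit_vectors[OF norm_u norm_u turns, folded \<nu>_def]
  have normal: "outward_unit_normal (obs (K (Suc n))) (x (Suc n)) (\<nu> n)" for n
  proof -
    have "\<nu> n \<bullet> (y - x (Suc n)) \<le> 0" if "y \<in> obs (K (Suc n))" for y
    proof -
      have "\<nu> n = - (inverse (norm (u (Suc n) - u n))) *\<^sub>R (u n - u (Suc n))"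
        by (simp add: \<nu>_def sgn_div_norm scaleR_diff_right)
      then show ?thesis using first_order[OF that] by simp
    qed
    with \<nu>(1) show ?thesis by (simp add: outward_unit_normal_def)
  qed
  have u_per: "u (n + P) = u n" for n
    using x(2)[of n] x(2)[of "Suc n"] by (simp add: u_def)
  obtain P' where P': "P = Suc P'" using P0 by (cases P) auto
  \<comment> \<open>The normal \<open>\<nu> n\<close> belongs to vertex \<open>Suc n\<close>.
    Passing to vertex \<open>n + P\<close> and translating back by one period covers vertex 0 as
    well.\<close>
  have frontier: "x n \<in> frontier (obs (K n))" for n
  proof -
    have "x (n + P) \<in> frontier (obs (K (n + P)))"
      using outward_unit_normal_frontier[OF normal x(1), of "n + P'"] P' by simp
    then show ?thesis by (simp add: x(2) per frontier_obstacle_shift_iff)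
  qed
  \<comment> \<open>Only the obstacles at the two ends of the edge can meet it. Each lies in the
    supporting half-space at its vertex, while the open edge is strictly outside of it, because
    \<open>u n \<bullet> \<nu> n < 0\<close> on arrival and the corresponding product is positive on
    departure.\<close>
  have free: "open_segment (x n) (x (Suc n)) \<inter> obs i = {}" if i: "i \<in> I" for n i
  proof (rule ccontr)
    assume "open_segment (x n) (x (Suc n)) \<inter> obs i \<noteq> {}"
    then obtain q where "q \<in> open_segment (x n) (x (Suc n))" and q1: "q \<in> obs i" by blast
    then obtain s where q2: "q = (1 - s) *\<^sub>R x n + s *\<^sub>R x (Suc n)" and s: "0 < s" "s < 1"
      unfolding in_segment by blast
    note q = q1 q2
    define l where "l = norm (x (Suc n) - x n)"
    have l: "0 < l" using ne by (simp add: l_def)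
    have diff: "x (Suc n) - x n = l *\<^sub>R u n" using ne by (simp add: l_def u_def sgn_div_norm)
    have "q \<in> convex hull (obs (K n) \<union> obs (K (Suc n)))"
      unfolding q(2) using s x(1) by (intro convexD[OF convex_convex_hull]) (auto intro: hull_inc)
    moreover have "\<not> between i (K n) (K (Suc n))" using vis[of n] unfolding visible_def by blast
    ultimately have "i = K n \<or> i = K (Suc n)"
      unfolding obstacle_between_def using q(1) i by blast
    then show False
    proof
      assume "i = K (Suc n)"
      then have "\<nu> n \<bullet> (q - x (Suc n)) \<le> 0"
        using normal q(1) by (simp add: outward_unit_normal_def)
      moreover have "q - x (Suc n) = - ((1 - s) *\<^sub>R (x (Suc n) - x n))"
        unfolding q(2) by (simp add: algebra_simps)
      then have "q - x (Suc n) = - (((1 - s) * l) *\<^sub>R u n)" unfolding diff by simp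
      moreover have "0 < (1 - s) * l" using s l by simp
      ultimately show False using \<nu>(3)[of n] by (simp add: inner_commute zero_le_mult_iff)
    next
      assume "i = K n"
      then have "q + lattice_vec k \<in> obs (K (n + P))"
        using q(1) by (simp add: per mem_obstacle_shift_iff)
      then have "\<nu> (n + P') \<bullet> ((q + lattice_vec k) - x (n + P)) \<le> 0"
        using normal[of "n + P'"] P' by (simp add: outward_unit_normal_def)
      moreover have "(q + lattice_vec k) - x (n + P) = s *\<^sub>R (x (Suc n) - x n)"
        unfolding q(2) x(2) by (simp add: algebra_simps)
      then have "(q + lattice_vec k) - x (n + P) = (s * l) *\<^sub>R u n" unfolding diff by simp
      moreover have "0 < s * l" using s l by simp
      moreover have "0 < u n \<bullet> \<nu> (n + P')"
        using \<nu>(4)[of "n + P'"] u_per[of n] P' by simp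
      ultimately show False using s l by (auto simp: inner_commute mult_le_0_iff)
    qed
  qed
  define T where "T = (\<Sum>n<P. norm (x (Suc n) - x n))"
  have T_pos: "0 < T"
    unfolding T_def using P0 ne by (intro sum_pos) auto
  have \<tau>_per: "\<tau> (n + P) = \<tau> n + T" for n
  proof (induction n)
    case (Suc n)
    then show ?case using x(2)[of n] x(2)[of "Suc n"] by (simp add: \<tau>_def)
  qed (simp add: \<tau>_def T_def)
  \<comment> \<open>Since \<open>T > 0\<close>, this makes the vertex times unbounded.\<close>
  have \<tau>_mult: "\<tau> (q * P) = real q * T" for q
  proof (induction q)
    case (Suc q)
    then show ?case using \<tau>_per[of "q * P"] by (simp add: algebra_simps)
  qed (simp add: \<tau>_def)
  have unbounded: "\<exists>n. t < \<tau> n" for t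
    using reals_Archimedean3[OF T_pos] \<tau>_mult by metis
  have law: "\<exists>\<nu>. outward_unit_normal (obs (K (Suc n))) (x (Suc n)) \<nu> \<and>
      u (Suc n) = u n - (2 * (u n \<bullet> \<nu>)) *\<^sub>R \<nu>" for n
    using normal \<nu>(2) by blast
  have "\<exists>\<gamma>. billiard_trajectory N Ob \<infinity> \<gamma> \<and> has_type N Ob \<infinity> \<gamma> K \<infinity> \<and>
    (\<forall>t\<ge>0. \<exists>n. \<tau> n \<le> t \<and> t < \<tau> (Suc n)) \<and>
    (\<forall>n. \<forall>t\<in>{\<tau> n..\<tau> (Suc n)}. \<gamma> t = x n + (t - \<tau> n) *\<^sub>R u n)"
  proof (rule polygon_trajectory[of K x, folded u_def \<tau>_def, OF K frontier ne free law unbounded])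
    fix \<gamma>
    assume \<gamma>: "billiard_trajectory N Ob \<infinity> \<gamma>" "has_type N Ob \<infinity> \<gamma> K \<infinity>"
      "\<And>t. 0 \<le> t \<Longrightarrow> \<exists>n. \<tau> n \<le> t \<and> t < \<tau> (Suc n)"
      "\<And>n t. \<tau> n \<le> t \<Longrightarrow> t \<le> \<tau> (Suc n) \<Longrightarrow> \<gamma> t = x n + (t - \<tau> n) *\<^sub>R u n"
    show ?thesis
      by (intro exI[of _ \<gamma>] conjI allI impI ballI \<gamma>) simp_all
  qed
  then obtain \<gamma> where \<gamma>: "billiard_trajectory N Ob \<infinity> \<gamma>" "has_type N Ob \<infinity> \<gamma> K \<infinity>"
    and locate: "\<forall>t\<ge>0. \<exists>n. \<tau> n \<le> t \<and> t < \<tau> (Suc n)"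
    and \<gamma>_eq: "\<forall>n. \<forall>t\<in>{\<tau> n..\<tau> (Suc n)}. \<gamma> t = x n + (t - \<tau> n) *\<^sub>R u n"
    by blast
  have \<gamma>_per: "\<gamma> (t + T) = \<gamma> t + lattice_vec k" if "0 \<le> t" for t
  proof -
    from locate that obtain n where n: "\<tau> n \<le> t" "t < \<tau> (Suc n)" by blast
    have 1: "\<gamma> (t + T) = x (n + P) + (t + T - \<tau> (n + P)) *\<^sub>R u (n + P)"
      by (rule \<gamma>_eq[rule_format]) (use n \<tau>_per[of n] \<tau>_per[of "Suc n"] in auto)
    have 2: "\<gamma> t = x n + (t - \<tau> n) *\<^sub>R u n"
      by (rule \<gamma>_eq[rule_format]) (use n in auto)
    show ?thesis unfolding 1 2 by (simp add: x(2) u_per \<tau>_per)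
  qed
  have "admissible_periodic_orbit N Ob T \<gamma>"
    unfolding admissible_periodic_orbit_def using \<gamma> T_pos adm \<gamma>_per by (auto simp: torus_proj_lattice)
  moreover have "displacement T \<gamma> = lattice_vec k"
    using \<gamma>_per[of 0] by (simp add: displacement_def)
  ultimately show ?thesis using that[of T \<gamma> x] T_def x(1) min by blast
qed

end

section \<open>Rotation vectors\<close>

text \<open>The difference splits into the error of the displacement and that of the length;
  \<open>norm d \<le> L\<close> makes each at most \<open>C / T\<close>.\<close>

lemma norm_rotation_vector_diff_le:
  fixes d d' :: "'a::real_normed_vector"
  assumes "0 < L" "0 < T" "norm d \<le> L" "\<bar>T - L\<bar> \<le> C" "norm (d' - d) \<le> C"
  shows "norm (d' /\<^sub>R T - d /\<^sub>R L) \<le> 2 * C / T"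
proof -
  have "d' /\<^sub>R T - d /\<^sub>R L = (d' - d) /\<^sub>R T + ((L - T) / (L * T)) *\<^sub>R d"
  proof -
    have "(L - T) / (L * T) = inverse T - inverse L" using assms(1,2) by (simp add: field_simps)
    then show ?thesis by (simp add: scaleR_left_diff_distrib scaleR_right_diff_distrib)
  qed
  also have "norm \<dots> \<le> norm (d' - d) / T + \<bar>L - T\<bar> / (L * T) * norm d"
    using assms(1,2) by (intro norm_triangle_le) (simp add: divide_inverse_commute abs_mult)
  also have "\<dots> \<le> C / T + C / (L * T) * L"
    using assms by (intro add_mono mult_mono divide_right_mono) auto
  also have "\<dots> = 2 * C / T" using assms(1,2) by simp
  finally show ?thesis .
qed

section \<open>Restriction and periodicity of trajectories\<close>

lemma billiard_trajectory_restrict: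
  assumes "billiard_trajectory N Ob L \<gamma>" "0 \<le> M" "M \<le> L"
  shows "billiard_trajectory N Ob M \<gamma>"
proof -
  have le: "ereal t \<le> L" if "ereal t \<le> M" for t using that assms(3) by (rule order_trans)
  have lt: "ereal t < L" if "ereal t < M" for t using that assms(3) by (rule order_less_le_trans)
  from assms(1) show ?thesis
    unfolding billiard_trajectory_def using assms(2) le lt by blast
qed

lemma trajectory_continuous_on:
  assumes bt: "billiard_trajectory N Ob \<infinity> \<gamma>"
  shows "continuous_on {0..} \<gamma>"
  unfolding continuous_on_iff
proof (intro ballI allI impI)
  fix t e :: real assume t: "t \<in> {0..}" and e: "0 < e"
  have "\<exists>w. outgoing_velocity \<gamma> t w"
    using bt t unfolding billiard_trajectory_def by auto
  then obtain w d1 where w: "norm w = 1" "d1 > 0" "\<And>s. t \<le> s \<Longrightarrow> s < t + d1 \<Longrightarrow> \<gamma> s = \<gamma> t + (s - t) *\<^sub>R w"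
    by (elim exE outgoing_velocityE) blast
  have "\<exists>d2>0. \<forall>s. 0 \<le> s \<longrightarrow> t - d2 < s \<longrightarrow> s \<le> t \<longrightarrow> dist (\<gamma> s) (\<gamma> t) \<le> \<bar>s - t\<bar>"
  proof (cases "t = 0")
    case False
    then have "\<exists>v. incoming_velocity \<gamma> t v"
      using bt t unfolding billiard_trajectory_def by auto
    then obtain v d2 where v: "norm v = 1" "d2 > 0" "\<And>s. t - d2 < s \<Longrightarrow> s \<le> t \<Longrightarrow> \<gamma> s = \<gamma> t + (s - t) *\<^sub>R v"
      by (elim exE incoming_velocityE) blast
    have "dist (\<gamma> s) (\<gamma> t) \<le> \<bar>s - t\<bar>" if "t - d2 < s" "s \<le> t" for s
      unfolding v(3)[OF that] by (simp add: dist_norm v(1))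
    with v(2) show ?thesis by blast
  qed (auto intro: exI[of _ 1])
  then obtain d2 where d2: "d2 > 0" "\<And>s. 0 \<le> s \<Longrightarrow> t - d2 < s \<Longrightarrow> s \<le> t \<Longrightarrow> dist (\<gamma> s) (\<gamma> t) \<le> \<bar>s - t\<bar>"
    by blast
  have "dist (\<gamma> s) (\<gamma> t) < e" if s: "s \<in> {0..}" "dist s t < min e (min d1 d2)" for s
  proof -
    have "dist (\<gamma> s) (\<gamma> t) \<le> \<bar>s - t\<bar>"
    proof (cases "t \<le> s")
      case True
      then have "\<gamma> s = \<gamma> t + (s - t) *\<^sub>R w" using s by (intro w(3)) (auto simp: dist_real_def)
      then show ?thesis by (simp add: dist_norm w(1))
    next
      case False
      then show ?thesis using s by (intro d2(2)) (auto simp: dist_real_def)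
    qed
    with s show ?thesis by (auto simp: dist_real_def)
  qed
  then show "\<exists>d>0. \<forall>s\<in>{0..}. dist s t < d \<longrightarrow> dist (\<gamma> s) (\<gamma> t) < e"
    using e w(2) d2(1) by (intro exI[of _ "min e (min d1 d2)"]) auto
qed

text \<open>Applied to \<open>\<gamma> (t + T) - \<gamma> t\<close>: periodicity on the torus
  provides a lattice vector for each time separately, and continuity makes it the same for all
  times.\<close>

lemma lattice_valued_constant:
  fixes f :: "real \<Rightarrow> real ^ 'm::finite"
  assumes "continuous_on {0..} f" "\<And>t. 0 \<le> t \<Longrightarrow> f t \<in> range lattice_vec" "0 \<le> t"
  shows "f t = f 0"
proof -
  have "f t $ a = f 0 $ a" for a
  proof -
    have "(\<lambda>t. f t $ a) constant_on {0..}"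
    proof (rule continuous_discrete_range_constant)
      show "continuous_on {0..} (\<lambda>t. f t $ a)"
        using assms(1) by (intro continuous_intros)
      fix s :: real assume "s \<in> {0..}"
      then obtain k :: "int ^ 'm" where k: "f s = lattice_vec k" using assms(2)[of s] by auto
      have "1 \<le> norm (f r $ a - f s $ a)" if r: "r \<in> {0..}" "f r $ a \<noteq> f s $ a" for r
      proof -
        obtain l :: "int ^ 'm" where l: "f r = lattice_vec l" using assms(2)[of r] r by auto
        then have "1 \<le> \<bar>l $ a - k $ a\<bar>" using r(2) k by auto
        then show ?thesis by (simp add: k l flip: of_int_diff of_int_abs)
      qed
      then show "\<exists>e>0. \<forall>y. y \<in> {0..} \<and> f y $ a \<noteq> f s $ a \<longrightarrow> e \<le> norm (f y $ a - f s $ a)"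
        by (intro exI[of _ 1]) auto
    qed simp
    with assms(3) show ?thesis unfolding constant_on_def by force
  qed
  then show ?thesis by (simp add: vec_eq_iff)
qed

context torus_obstacles
begin

text \<open>The lift moves by one fixed lattice vector per period. As time 0 is a contact,
  \<open>\<gamma> (real n * T)\<close> is a translate of a contact point, so cutting there yields a
  piece whose type is an initial part of \<open>K\<close>.\<close>

lemma periodic_rotation_vectors_subset:
  "periodic_rotation_vectors N Ob \<subseteq> admissible_rotation_set N Ob"
proof
  fix \<rho> assume "\<rho> \<in> periodic_rotation_vectors N Ob"
  then obtain T \<gamma> K where \<rho>: "\<rho> = displacement T \<gamma> /\<^sub>R T" and bt: "billiard_trajectory N Ob \<infinity> \<gamma>"
    and T: "0 < T" and per: "\<And>t. 0 \<le> t \<Longrightarrow> torus_proj (\<gamma> (t + T)) = torus_proj (\<gamma> t)"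
    and ty: "has_type N Ob \<infinity> \<gamma> K \<infinity>" and adm: "admissible_sequence N Ob K \<infinity>"
    by (auto simp: periodic_rotation_vectors_def admissible_periodic_orbit_def)
  define f where "f t = \<gamma> (t + T) - \<gamma> t" for t
  have f_lattice: "f t \<in> range lattice_vec" if "0 \<le> t" for t
    by (rule torus_proj_eqD[OF per[OF that]]) (simp add: f_def)
  have cont: "continuous_on {0..} \<gamma>" by (rule trajectory_continuous_on[OF bt])
  have "continuous_on {0..} (\<lambda>t. \<gamma> (t + T))"
    by (rule continuous_on_compose2[OF cont]) (use T in \<open>auto intro!: continuous_intros\<close>)
  with cont have "continuous_on {0..} f"
    unfolding f_def by (intro continuous_on_diff)
  then have f_const: "f t = f 0" if "0 \<le> t" for t
    using lattice_valued_constant[of f t] f_lattice that by blast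
  obtain k where k: "f 0 = lattice_vec k" using f_lattice[of 0] by auto
  have mult: "\<gamma> (real n * T) = \<gamma> 0 + real n *\<^sub>R lattice_vec k" for n
  proof (induction n)
    case (Suc n)
    have "\<gamma> (real (Suc n) * T) = \<gamma> (real n * T) + f (real n * T)"
      by (simp add: f_def algebra_simps)
    also have "f (real n * T) = lattice_vec k" using f_const[of "real n * T"] T k by simp
    finally show ?case using Suc by (simp add: algebra_simps)
  qed simp
  obtain \<tau> where sm: "strict_mono \<tau>" and \<tau>0: "\<tau> 0 = 0"
    and contacts: "{t. 0 \<le> t \<and> (\<exists>i\<in>I. \<gamma> t \<in> frontier (obs i))} = range \<tau>"
    and K: "\<And>n. K n \<in> I" "\<And>n. \<gamma> (\<tau> n) \<in> frontier (obs (K n))"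
    using ty unfolding has_type_def by (auto simp: strict_mono_def)
  have piece: "admissible_piece N Ob (real n * T) \<gamma>" for n
  proof -
    have "\<gamma> (real n * T) \<in> frontier (obs (shift (int n *s k) (K 0)))"
      unfolding mult lattice_vec_smult[symmetric] frontier_obstacle_shift_iff using K(2)[of 0] \<tau>0 by simp
    then have "real n * T \<in> {t. 0 \<le> t \<and> (\<exists>i\<in>I. \<gamma> t \<in> frontier (obs i))}"
      using T K(1)[of 0] by (auto intro!: bexI[of _ "shift (int n *s k) (K 0)"])
    then obtain q where q: "real n * T = \<tau> q" unfolding contacts by auto
    have "{t. 0 \<le> t \<and> ereal t \<le> ereal (\<tau> q) \<and> (\<exists>i\<in>I. \<gamma> t \<in> frontier (obs i))} = range \<tau> \<inter> {..\<tau> q}"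
      unfolding contacts[symmetric] by auto
    also have "\<dots> = \<tau> ` {n. enat n \<le> enat q}"
      using strict_mono_less_eq[OF sm] by auto
    finally have "has_type N Ob (ereal (\<tau> q)) \<gamma> K (enat q)"
      unfolding has_type_def using sm \<tau>0 K
      by (intro exI[of _ \<tau>]) (auto simp: strict_mono_on_def strict_mono_def)
    moreover have "admissible_sequence N Ob K (enat q)"
      using adm by (simp add: admissible_sequence_def)
    moreover have "billiard_trajectory N Ob (ereal (\<tau> q)) \<gamma>"
      by (rule billiard_trajectory_restrict[OF bt]) (use q T in \<open>simp_all flip: q\<close>)
    ultimately show ?thesis unfolding admissible_piece_def q by blast
  qed
  show "\<rho> \<in> admissible_rotation_set N Ob"
    unfolding admissible_rotation_set_def mem_Collect_eq
  \<comment> \<open>The subsequence \<open>Suc\<close> skips the piece of length 0; all other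
    quotients equal \<open>\<rho>\<close> exactly.\<close>
  proof (intro exI[of _ "\<lambda>n. real n * T"] exI[of _ "\<lambda>_. \<gamma>"] exI[of _ Suc] conjI allI)
    show "admissible_piece N Ob (real n * T) \<gamma>" for n by (rule piece)
    show "filterlim (\<lambda>n. real n * T) at_top sequentially"
      by (rule filterlim_at_top_mult_tendsto_pos[OF tendsto_const T filterlim_real_sequentially])
    show "strict_mono Suc" by (simp add: strict_mono_def)
    have "displacement (real (Suc n) * T) \<gamma> /\<^sub>R (real (Suc n) * T) = \<rho>" for n
    proof -
      have "displacement (real m * T) \<gamma> = real m *\<^sub>R lattice_vec k" for m
        by (simp add: displacement_def mult)
      from this[of "Suc n"] this[of 1] show ?thesis by (simp add: \<rho>)
    qed
    then show "(\<lambda>n. displacement (real (Suc n) * T) \<gamma> /\<^sub>R (real (Suc n) * T)) \<longlonglongrightarrow> \<rho>"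
      by simp
  qed
qed

text \<open>
  Both estimates of the period rest on minimality: the piece is the shortest polygon of its type
  up to the position of its endpoints, and the periodic orbit is the shortest closed polygon of
  its type.
\<close>

lemma admissible_piece_shadowed:
  obtains C where "\<And>L \<gamma>. admissible_piece N Ob L \<gamma> \<Longrightarrow> 0 < L \<Longrightarrow>
    norm (displacement L \<gamma>) \<le> L \<and>
    (\<exists>T \<gamma>'. admissible_periodic_orbit N Ob T \<gamma>' \<and> \<bar>T - L\<bar> \<le> C \<and>
      norm (displacement T \<gamma>' - displacement L \<gamma>) \<le> C)"
proof -
  obtain C where C: "\<And>K p. admissible_sequence N Ob K (enat p) \<Longrightarrow> 1 \<le> p \<Longrightarrow>
    \<exists>P K'. p < P \<and> (\<forall>m\<le>p. K' m = K m) \<and> admissible_sequence N Ob K' \<infinity> \<and>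
      (\<forall>m. K' (m + P) = shift (fst (K p)) (K' m)) \<and>
      (\<Sum>m = p..<P. jump_bound (K' m, K' (Suc m))) \<le> C"
    using close_admissible_sequence by blast
  \<comment> \<open>Two points of one obstacle differ by at most \<open>D / 2\<close>, by
    \<open>jump_bound\<close> with equal arguments; both ends of the piece together cost
    \<open>D\<close>.\<close>
  define D where "D = 4 * real CARD('m)"
  have same: "norm (y - x) \<le> D / 2" if "i \<in> I" "x \<in> obs i" "y \<in> obs i" for i x y
    using norm_diff_le_jump_bound[OF that(1,1,2,3)] by (simp add: jump_bound_def D_def)
  show ?thesis
  proof (rule that[of "max C D"])
    fix L \<gamma> assume piece: "admissible_piece N Ob L \<gamma>" and L: "0 < L"
    then obtain K p where bt: "billiard_trajectory N Ob (ereal L) \<gamma>"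
      and ty: "has_type N Ob (ereal L) \<gamma> K (enat p)" and adm: "admissible_sequence N Ob K (enat p)"
      by (auto simp: admissible_piece_def)
    obtain \<tau> u where \<tau>: "\<tau> 0 = 0" "\<tau> p = L"
      "\<And>n. n < p \<Longrightarrow> \<tau> n < \<tau> (Suc n)"
      "\<And>n. n \<le> p \<Longrightarrow> K n \<in> I \<and> \<gamma> (\<tau> n) \<in> obs (K n)"
      "\<And>n. n < p \<Longrightarrow> norm (u n) = 1"
      "\<And>n. n < p \<Longrightarrow> \<gamma> (\<tau> (Suc n)) = \<gamma> (\<tau> n) + (\<tau> (Suc n) - \<tau> n) *\<^sub>R u n"
      using trajectory_piece_segments[OF bt ty] by metis
    have p: "1 \<le> p" using \<tau>(1,2) L by (cases p) auto
    have step: "norm (\<gamma> (\<tau> (Suc n)) - \<gamma> (\<tau> n)) = \<tau> (Suc n) - \<tau> n" if "n < p" for n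
      using \<tau>(3,5,6)[OF that] by simp
    have L_sum: "(\<Sum>n<p. norm (\<gamma> (\<tau> (Suc n)) - \<gamma> (\<tau> n))) = L"
    proof -
      have "(\<Sum>n<p. norm (\<gamma> (\<tau> (Suc n)) - \<gamma> (\<tau> n))) = (\<Sum>n<p. \<tau> (Suc n) - \<tau> n)"
        using step by (intro sum.cong) auto
      then show ?thesis using \<tau>(1,2) by (simp add: sum_lessThan_telescope)
    qed
    have "displacement L \<gamma> = (\<Sum>n<p. \<gamma> (\<tau> (Suc n)) - \<gamma> (\<tau> n))"
      using sum_lessThan_telescope[of "\<lambda>n. \<gamma> (\<tau> n)" p] \<tau>(1,2) by (simp add: displacement_def)
    then have norm_le: "norm (displacement L \<gamma>) \<le> L" using norm_sum L_sum by metis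
    have K0: "fst (K 0) = 0" using adm by (simp add: admissible_sequence_def)
    define k where "k = fst (K p)"
    obtain P K' where P: "p < P" and K': "\<And>m. m \<le> p \<Longrightarrow> K' m = K m"
      and adm': "admissible_sequence N Ob K' \<infinity>" and per: "\<And>m. K' (m + P) = shift k (K' m)"
      and cost: "(\<Sum>m = p..<P. jump_bound (K' m, K' (Suc m))) \<le> C"
      using C[OF adm p] unfolding k_def by blast
    have K'I: "K' m \<in> I" for m using adm' by (simp add: admissible_sequence_def)
    have "2 \<le> P" using P p by simp
    obtain T \<gamma>' x where orbit: "admissible_periodic_orbit N Ob T \<gamma>'" "displacement T \<gamma>' = lattice_vec k"
      and T: "T = (\<Sum>n<P. norm (x (Suc n) - x n))" and x: "\<And>m. x m \<in> obs (K' m)"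
      and T_min: "\<And>y. (\<And>m. y m \<in> obs (K' m)) \<Longrightarrow> (\<And>m. y (m + P) = y m + lattice_vec k) \<Longrightarrow>
         T \<le> (\<Sum>n<P. norm (y (Suc n) - y n))"
      using admissible_periodic_orbit_exists[of K' P k, OF adm' per \<open>2 \<le> P\<close>] by blast
    have ends: "\<gamma> 0 \<in> obs (K 0)" "\<gamma> L \<in> obs (K p)" "K 0 \<in> I" "K p \<in> I"
      using \<tau>(4)[of 0] \<tau>(4)[of p] \<tau>(1,2) by auto
    have "L \<le> (\<Sum>n<p. norm (x (Suc n) - x n)) + norm (x 0 - \<gamma> 0) + norm (x p - \<gamma> L)"
      by (rule trajectory_piece_length_minimal[OF bt ty]) (use x K' in metis)
    also have "(\<Sum>n<p. norm (x (Suc n) - x n)) \<le> T"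
      unfolding T using P by (intro sum_mono2) auto
    also have "norm (x 0 - \<gamma> 0) \<le> D / 2" using same[OF ends(3,1)] x[of 0] K'[of 0] by simp
    also have "norm (x p - \<gamma> L) \<le> D / 2" using same[OF ends(4,2)] x[of p] K'[of p] by simp
    finally have lower: "L \<le> T + D" by simp
    \<comment> \<open>The competitor for the minimality of the orbit: the contact points of the
      piece up to \<open>p\<close>, so that its first \<open>p\<close> edges have total length
      exactly \<open>L\<close>, and then arbitrary points of the connecting obstacles, whose edges
      \<open>jump_bound\<close> controls.\<close>
    define z where "z m = (if m \<le> p then \<gamma> (\<tau> m) else x m)" for m
    define y where "y = wrap P (lattice_vec k) z"
    have "z m \<in> obs (K' m)" for m using \<tau>(4) K' x by (simp add: z_def)
    then have y_mem: "y m \<in> obs (K' m)" for m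
      unfolding y_def using P by (intro wrap_mem[of K' P k z, OF per]) auto
    have y_per: "y (m + P) = y m + lattice_vec k" for m
      unfolding y_def using P by (intro wrap_add_period) simp
    have "T \<le> (\<Sum>n<P. norm (y (Suc n) - y n))" by (rule T_min[OF y_mem y_per])
    also have "{..<P} = {..<p} \<union> {p..<P}" using P by auto
    also have "(\<Sum>n\<in>{..<p} \<union> {p..<P}. norm (y (Suc n) - y n)) =
        (\<Sum>n<p. norm (y (Suc n) - y n)) + (\<Sum>n=p..<P. norm (y (Suc n) - y n))"
      by (rule sum.union_disjoint) auto
    also have "(\<Sum>n<p. norm (y (Suc n) - y n)) = L"
      unfolding L_sum[symmetric] y_def using P by (intro sum.cong) (auto simp: z_def)
    also have "(\<Sum>n=p..<P. norm (y (Suc n) - y n)) \<le> (\<Sum>n=p..<P. jump_bound (K' n, K' (Suc n)))"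
      by (intro sum_mono norm_diff_le_jump_bound K'I y_mem)
    also note cost
    finally have upper: "T \<le> L + C" by simp
    \<comment> \<open>The ends of the piece are close to the corners of their cubes, which are 0 and
      \<open>lattice_vec k\<close>.\<close>
    have "norm (lattice_vec k - displacement L \<gamma>) \<le> norm (\<gamma> L - lattice_vec (fst (K p))) + norm (\<gamma> 0 - lattice_vec (fst (K 0)))"
      using norm_triangle_ineq4[of "\<gamma> 0 - lattice_vec (fst (K 0))" "\<gamma> L - lattice_vec (fst (K p))"]
      by (simp add: displacement_def k_def K0 algebra_simps)
    also have "\<dots> \<le> D"
      using obstacle_norm_diff_le[OF ends(3,1)] obstacle_norm_diff_le[OF ends(4,2)] by (simp add: D_def)
    finally have "norm (displacement T \<gamma>' - displacement L \<gamma>) \<le> max C D" by (simp add: orbit(2))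
    moreover have "\<bar>T - L\<bar> \<le> max C D" using lower upper by (simp add: abs_le_iff max_def)
    ultimately show "norm (displacement L \<gamma>) \<le> L \<and>
      (\<exists>T \<gamma>'. admissible_periodic_orbit N Ob T \<gamma>' \<and> \<bar>T - L\<bar> \<le> max C D \<and>
        norm (displacement T \<gamma>' - displacement L \<gamma>) \<le> max C D)"
      using norm_le orbit(1) by blast
  qed
qed

lemma admissible_rotation_set_subset_closure:
  "admissible_rotation_set N Ob \<subseteq> closure (periodic_rotation_vectors N Ob)"
proof
  fix \<rho> assume "\<rho> \<in> admissible_rotation_set N Ob"
  then obtain L \<gamma> \<sigma> where piece: "\<And>n. admissible_piece N Ob (L n) (\<gamma> n)"
    and L: "filterlim L at_top sequentially" and \<sigma>: "strict_mono (\<sigma> :: nat \<Rightarrow> nat)"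
    and lim: "(\<lambda>n. displacement (L (\<sigma> n)) (\<gamma> (\<sigma> n)) /\<^sub>R L (\<sigma> n)) \<longlonglongrightarrow> \<rho>"
    unfolding admissible_rotation_set_def by blast
  obtain C where C: "\<And>L \<gamma>. admissible_piece N Ob L \<gamma> \<Longrightarrow> 0 < L \<Longrightarrow>
    norm (displacement L \<gamma>) \<le> L \<and>
    (\<exists>T \<gamma>'. admissible_periodic_orbit N Ob T \<gamma>' \<and> \<bar>T - L\<bar> \<le> C \<and>
      norm (displacement T \<gamma>' - displacement L \<gamma>) \<le> C)"
    using admissible_piece_shadowed by blast
  show "\<rho> \<in> closure (periodic_rotation_vectors N Ob)"
    unfolding closure_approachable
  proof (intro allI impI)
    fix e :: real assume e: "0 < e"
    have "filterlim (\<lambda>n. L (\<sigma> n)) at_top sequentially"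
      using filterlim_compose[OF L filterlim_subseq[OF \<sigma>]] .
    \<comment> \<open>The threshold is made so that \<open>T \<ge> L - C\<close> still exceeds
      \<open>4 * C / e\<close>, whence \<open>2 * C / T < e / 2\<close>. The absolute value is there
      because \<open>C \<ge> 0\<close> becomes known only once a piece exists.\<close>
    then have "\<forall>\<^sub>F n in sequentially. max 1 (C + 1 + 4 * \<bar>C\<bar> / e) \<le> L (\<sigma> n)"
      by (rule filterlim_at_top[THEN iffD1, rule_format])
    moreover have "\<forall>\<^sub>F n in sequentially. dist (displacement (L (\<sigma> n)) (\<gamma> (\<sigma> n)) /\<^sub>R L (\<sigma> n)) \<rho> < e / 2"
      using lim e by (intro tendstoD) simp_all
    ultimately have "\<forall>\<^sub>F n in sequentially. max 1 (C + 1 + 4 * \<bar>C\<bar> / e) \<le> L (\<sigma> n) \<and>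
        dist (displacement (L (\<sigma> n)) (\<gamma> (\<sigma> n)) /\<^sub>R L (\<sigma> n)) \<rho> < e / 2"
      by (rule eventually_conj)
    from eventually_happens'[OF sequentially_bot this] obtain n where n: "max 1 (C + 1 + 4 * \<bar>C\<bar> / e) \<le> L (\<sigma> n)"
      "dist (displacement (L (\<sigma> n)) (\<gamma> (\<sigma> n)) /\<^sub>R L (\<sigma> n)) \<rho> < e / 2"
      by blast
    define M where "M = L (\<sigma> n)"
    define d where "d = displacement M (\<gamma> (\<sigma> n))"
    have M: "0 < M" "C + 1 + 4 * \<bar>C\<bar> / e \<le> M" using n(1) by (simp_all add: M_def)
    obtain T \<gamma>' where orbit: "admissible_periodic_orbit N Ob T \<gamma>'" and T: "\<bar>T - M\<bar> \<le> C"
      and d: "norm d \<le> M" "norm (displacement T \<gamma>' - d) \<le> C"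
      using C[OF piece[of "\<sigma> n"]] M(1) unfolding M_def d_def by blast
    have C0: "0 \<le> C" using d(2) norm_ge_zero order_trans by blast
    have "1 + 4 * C / e \<le> T" using M(2) T C0 by simp
    moreover have "0 \<le> 4 * C / e" using C0 e by simp
    ultimately have T0: "0 < T" "4 * C / e < T" by linarith+
    have "norm (displacement T \<gamma>' /\<^sub>R T - d /\<^sub>R M) \<le> 2 * C / T"
      by (rule norm_rotation_vector_diff_le[OF M(1) T0(1) d(1) T d(2)])
    also have "\<dots> < e / 2" using T0 e by (simp add: field_simps)
    finally have "dist (displacement T \<gamma>' /\<^sub>R T) (d /\<^sub>R M) < e / 2" by (simp add: dist_norm)
    with n(2) have "dist (displacement T \<gamma>' /\<^sub>R T) \<rho> < e"
      unfolding M_def[symmetric] d_def[symmetric]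
      using dist_triangle[of "displacement T \<gamma>' /\<^sub>R T" \<rho> "d /\<^sub>R M"] by simp
    moreover have "displacement T \<gamma>' /\<^sub>R T \<in> periodic_rotation_vectors N Ob"
      unfolding periodic_rotation_vectors_def using orbit by blast
    ultimately show "\<exists>y\<in>periodic_rotation_vectors N Ob. dist y \<rho> < e" by blast
  qed
qed

end

theorem theorem4p2:
  fixes Ob :: "nat \<Rightarrow> (real ^ 'm::finite) set set" and N :: nat
  assumes "CARD('m) \<ge> 2" and "N \<ge> 1"
    and "\<And>r. r \<in> {1..N} \<Longrightarrow> Ob r \<subseteq> range torus_proj"
    and "\<And>r s. r \<in> {1..N} \<Longrightarrow> s \<in> {1..N} \<Longrightarrow> r \<noteq> s \<Longrightarrow> Ob r \<inter> Ob s = {}"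
    and "\<And>r. r \<in> {1..N} \<Longrightarrow> base_obstacle Ob r \<subseteq> interior (cbox 0 1)"
    and "\<And>r. r \<in> {1..N} \<Longrightarrow> strictly_convex_body (base_obstacle Ob r)"
    and "\<And>r. r \<in> {1..N} \<Longrightarrow> C2_boundary (base_obstacle Ob r)"
    and "\<And>r. r \<in> {1..N} \<Longrightarrow> diameter (base_obstacle Ob r) < sqrt 2 / 4"
    and "\<And>i r s. r \<in> {1..N} \<Longrightarrow> s \<in> {1..N} \<Longrightarrow> r \<noteq> s \<Longrightarrow>
           (\<lambda>x. x $ i) ` base_obstacle Ob r \<inter> (\<lambda>x. x $ i) ` base_obstacle Ob s = {}"
    and "\<And>r s t. r \<in> {1..N} \<Longrightarrow> s \<in> {1..N} \<Longrightarrow> t \<in> {1..N} \<Longrightarrow> r \<noteq> s \<Longrightarrow> r \<noteq> t \<Longrightarrow> s \<noteq> t \<Longrightarrow>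
           convex hull (base_obstacle Ob r \<union> base_obstacle Ob s) \<inter> base_obstacle Ob t = {}"
  shows "periodic_rotation_vectors N Ob \<subseteq> admissible_rotation_set N Ob \<and>
         admissible_rotation_set N Ob \<subseteq> closure (periodic_rotation_vectors N Ob)"
proof -
  interpret torus_obstacles N Ob
  proof
    show "base_obstacle Ob r \<subseteq> box 0 1" if "r \<in> {1..N}" for r
      using assms(5)[OF that] by simp
  qed (fact assms)+
  show ?thesis
    using periodic_rotation_vectors_subset admissible_rotation_set_subset_closure by blast
qed

end
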